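(* Let $d,n\ge 2$, let $\mathcal D$ be a domain in $Q_0(d,n)$ whose closure $\overline{\mathcal D}$ is a compact subset of $Q_0(d,n)$, and let $\mathfrak P$ be a reduction of $\mathcal V(d,n)$ to a principal $K$-bundle over $\overline{\mathcal D}$. Let $T$ be the conditional expectation from $\Gamma_c(\partial\mathcal D,\mathfrak M^*(\mathfrak P;d,n))$ onto its center given by $T(\sigma)=(\tau\circ\sigma)\cdot\varepsilon$. Then $T$ maps $\mathbb S(\mathcal D,\mathfrak P;d,n)$ onto $\mathbb I(\mathcal D;d,n)$, and $\mathbb I(\mathcal D;d,n)$ is the center of $\mathbb S(\mathcal D,\mathfrak P;d,n)$.
   Context: Setting. $G=PGL(n,\mathbb C)$, $K=PU(n,\mathbb C)$, acting on $M_n(\mathbb C)$ by $s\cdot A=sAs^{-1}$ and on $M_n(\mathbb C)^d$ on the right by $\mathfrak z\cdot s=s^{-1}\mathfrak z s=(s^{-1}Z_1s,\dots,s^{-1}Z_ds)$. $\mathcal V(d,n)$ is the set of $\mathfrak z=(Z_1,\dots,Z_d)\in M_n(\mathbb C)^d$ such that $Z_1,\dots,Z_d$ generate the algebra $M_n(\mathbb C)$. $\mathbb I_0(d,n)$ is the algebra of $G$-invariant polynomial functions $M_n(\mathbb C)^d\to\mathbb C$; $p\in\mathbb I_0(d,n)$ is also identified with the matrix-valued function $\mathfrak z\mapsto p(\mathfrak z)I_n$. $\mathbb G_0(d,n)$ is the algebra of functions $M_n(\mathbb C)^d\to M_n(\mathbb C)$ generated by the coordinate functions $\mathcal Z_i(\mathfrak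 z)=Z_i$, and $\mathbb S_0(d,n)$ (the trace algebra) is the algebra generated by $\mathbb G_0(d,n)$ and $\mathbb I_0(d,n)$; its elements $\phi$ satisfy $\phi(s^{-1}\mathfrak z s)=s^{-1}\phi(\mathfrak z)s$. $Q(d,n)$ is the spectrum of the finitely generated algebra $\mathbb I_0(d,n)$, with its analytic topology, $\pi_0:M_n(\mathbb C)^d\to Q(d,n)$ is the surjection dual to the inclusion of $\mathbb I_0(d,n)$ in the polynomial functions, and $Q_0(d,n)=\pi_0(\mathcal V(d,n))$. By a theorem of Procesi (may be assumed), $Q_0(d,n)$ is an open subset of the smooth points of $Q(d,n)$ and $\pi_0:\mathcal V(d,n)\to Q_0(d,n)$ is a holomorphic principal $G$-bundle; write $[\mathfrak z]=\pi_0(\mathfrak z)$. Elements of $\mathbb I_0(d,n)$ are regarded as regular functions on $Q(d,n)$. Function algebra. $\mathbb I(\mathcal D;d,n)$ is the sup-norm closure of (the restrictions to $\overline{\mathcal D}$ of) $\mathbb I_0(d,n)$ in $C(\overline{\mathcal D})$; it is a function algebra on $\overline{\mathcal D}$, and $\partial\mathcal D\subseteq\overline{\mathcal D}$ is its Shilov boundary. Reductions and bundles. A reduction $\mathfrak P$ of $\mathcal V(d,n)$ to a principal $K$-bundle over $\overline{\mathcal D}$ is the principal $K$-bundle given by a compact $K$-invariant subset $\mathcal P\subseteq\mathcal V(d,n)$ which $\pi_0$ maps onto $\overline{\mathcal D}$ and for which $\pi_0$ identifies $\mathcal P/K$ with $\overline{\mathcal D}$. $\mathfrak M^*(\mathfrak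 P;d,n)$ is the associated $M_n(\mathbb C)$-bundle, with total space $\mathcal P\times_K M_n(\mathbb C)$ (quotient of $\mathcal P\times M_n(\mathbb C)$ by $(\mathfrak z,A)\cdot k=(k^{-1}\mathfrak z k,k^{-1}Ak)$) and projection $\pi([\mathfrak z,A])=[\mathfrak z]$; each fibre $\pi^{-1}(\mathfrak u)$ is a $C^*$-algebra isomorphic to $M_n(\mathbb C)$ via $A\mapsto[\mathfrak z,A]$ for any $\mathfrak z\in\mathcal P$ with $\pi_0(\mathfrak z)=\mathfrak u$. $\Gamma_c(\partial\mathcal D,\mathfrak M^*(\mathfrak P;d,n))$ is the $C^*$-algebra of continuous cross sections over $\partial\mathcal D$, with fibrewise operations and the supremum norm. For $\phi\in\mathbb S_0(d,n)$, $\Psi(\phi)$ is the section $\Psi(\phi)([\mathfrak z])=[\mathfrak z,\phi(\mathfrak z)]$, $\mathfrak z\in\mathcal P$. $\mathbb S(\mathcal D,\mathfrak P;d,n)$ (the tracial function algebra) is the norm closure of $\Psi(\mathbb S_0(d,n))$ in $\Gamma_c(\partial\mathcal D,\mathfrak M^*(\mathfrak P;d,n))$. Center and expectation. $\varepsilon$ is the identity section $\varepsilon([\mathfrak z])=[\mathfrak z,I_n]$. The center of $\Gamma_c(\partial\mathcal D,\mathfrak M^*(\mathfrak P;d,n))$ consists of the sections $c\cdot\varepsilon$, $(c\cdot\varepsilon)([\mathfrak z])=[\mathfrak z,c([\mathfrak z])I_n]$, with $c\in C(\partial\mathcal D)$, and is identified with $C(\partial\mathcal D)$. $\mathbb I(\mathcal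 D;d,n)$ is regarded as a subalgebra of this center (and of $\mathbb S(\mathcal D,\mathfrak P;d,n)$) via $f\mapsto f|_{\partial\mathcal D}\cdot\varepsilon$. $\tau_0$ is the normalized trace on $M_n(\mathbb C)$ ($\tau_0(I_n)=1$), and $\tau:\mathfrak M^*(\mathfrak P;d,n)\to\mathbb C$ is the well-defined continuous function $\tau([\mathfrak z,A])=\tau_0(A)$. *)

theory Defs
  imports "HOL-Analysis.Analysis"
begin

type_synonym 'n cmat = "((complex, 'n) vec, 'n) vec"
type_synonym ('d, 'n) mtuple = "('n cmat, 'd) vec"

section \<open>Matrices and group actions\<close>

(* PGL(n,C) and PU(n,C) act by conjugation, on which scalar matrices act trivially; the actions are
   therefore written with representatives in GL(n,C) (invertible matrices) and U(n). *)

definition cadjoint :: "('n::finite) cmat \<Rightarrow> 'n cmat" where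
  "cadjoint A = map_matrix cnj (transpose A)"

definition unitary_group :: "('n::finite) cmat set" where
  "unitary_group = {k. cadjoint k ** k = mat 1 \<and> k ** cadjoint k = mat 1}"

definition conj_mat :: "'n cmat \<Rightarrow> ('n::finite) cmat \<Rightarrow> 'n cmat" where
  "conj_mat s A = matrix_inv s ** A ** s"

definition conj_tuple :: "'n cmat \<Rightarrow> ('d::finite, 'n::finite) mtuple \<Rightarrow> ('d, 'n) mtuple" where
  "conj_tuple s z = (\<chi> i. conj_mat s (z $ i))"

(* A complex scalar multiple of A is "mat c ** A", so closure under "mat c", sums and products
   is closure under the unital complex algebra operations. *)
inductive_set mat_alg :: "('n::finite) cmat set \<Rightarrow> 'n cmat set" for S where
  gen: "A \<in> S \<Longrightarrow> A \<in> mat_alg S"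
| scalar: "mat c \<in> mat_alg S"
| add: "A \<in> mat_alg S \<Longrightarrow> B \<in> mat_alg S \<Longrightarrow> A + B \<in> mat_alg S"
| mult: "A \<in> mat_alg S \<Longrightarrow> B \<in> mat_alg S \<Longrightarrow> A ** B \<in> mat_alg S"

definition Vset :: "('d::finite, 'n::finite) mtuple set" where
  "Vset = {z. mat_alg (range (\<lambda>i. z $ i)) = UNIV}"

section \<open>Invariant polynomials and the trace algebra\<close>

inductive_set poly_funs :: "(('d::finite, 'n::finite) mtuple \<Rightarrow> complex) set" where
  const: "(\<lambda>z. c) \<in> poly_funs"
| coord: "(\<lambda>z. z $ i $ a $ b) \<in> poly_funs"
| add: "p \<in> poly_funs \<Longrightarrow> q \<in> poly_funs \<Longrightarrow> (\<lambda>z. p z + q z) \<in> poly_funs"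
| mult: "p \<in> poly_funs \<Longrightarrow> q \<in> poly_funs \<Longrightarrow> (\<lambda>z. p z * q z) \<in> poly_funs"

definition I0 :: "(('d::finite, 'n::finite) mtuple \<Rightarrow> complex) set" where
  "I0 = {p \<in> poly_funs. \<forall>s z. invertible s \<longrightarrow> p (conj_tuple s z) = p z}"

inductive_set mat_fun_alg ::
  "(('d::finite, 'n::finite) mtuple \<Rightarrow> 'n cmat) set \<Rightarrow> (('d, 'n) mtuple \<Rightarrow> 'n cmat) set" for S where
  gen: "f \<in> S \<Longrightarrow> f \<in> mat_fun_alg S"
| scalar: "(\<lambda>z. mat c) \<in> mat_fun_alg S"
| add: "f \<in> mat_fun_alg S \<Longrightarrow> g \<in> mat_fun_alg S \<Longrightarrow> (\<lambda>z. f z + g z) \<in> mat_fun_alg S"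
| mult: "f \<in> mat_fun_alg S \<Longrightarrow> g \<in> mat_fun_alg S \<Longrightarrow> (\<lambda>z. f z ** g z) \<in> mat_fun_alg S"

definition G0 :: "(('d::finite, 'n::finite) mtuple \<Rightarrow> 'n cmat) set" where
  "G0 = mat_fun_alg (range (\<lambda>i z. z $ i))"

definition S0 :: "(('d::finite, 'n::finite) mtuple \<Rightarrow> 'n cmat) set" where
  "S0 = mat_fun_alg (G0 \<union> {\<lambda>z. mat (p z) |p. p \<in> I0})"

section \<open>The quotient variety\<close>

(* A point of the spectrum of the finitely generated algebra I0 is a maximal ideal, equivalently a
   unital algebra homomorphism u from I0 to the complex numbers; the regular function p takes the
   value u p at u.  Homomorphisms are extensional on I0.  The analytic topology is the one induced
   from any closed embedding into affine space given by finitely many generators, i.e. the coarsest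
   one making every regular function continuous; this is the topology of pointwise convergence. *)

type_synonym ('d, 'n) qpoint = "(('d, 'n) mtuple \<Rightarrow> complex) \<Rightarrow> complex"

definition Qset :: "('d::finite, 'n::finite) qpoint set" where
  "Qset = {u \<in> extensional I0.
     (\<forall>c. u (\<lambda>z. c) = c) \<and>
     (\<forall>p\<in>I0. \<forall>q\<in>I0. u (\<lambda>z. p z + q z) = u p + u q) \<and>
     (\<forall>p\<in>I0. \<forall>q\<in>I0. u (\<lambda>z. p z * q z) = u p * u q)}"

definition Qtop :: "('d::finite, 'n::finite) qpoint topology" where
  "Qtop = subtopology (product_topology (\<lambda>p. euclidean) I0) Qset"

definition pi0 :: "('d::finite, 'n::finite) mtuple \<Rightarrow> ('d, 'n) qpoint" where
  "pi0 z = (\<lambda>p\<in>I0. p z)"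

definition Q0 :: "('d::finite, 'n::finite) qpoint set" where
  "Q0 = pi0 ` Vset"

definition domain_in_Q0 :: "('d::finite, 'n::finite) qpoint set \<Rightarrow> bool" where
  "domain_in_Q0 D \<longleftrightarrow> D \<noteq> {} \<and> openin (subtopology Qtop Q0) D \<and> connectedin Qtop D"

section \<open>The function algebra and its Shilov boundary\<close>

definition restrict_I0 :: "('d::finite, 'n::finite) qpoint set \<Rightarrow> (('d, 'n) qpoint \<Rightarrow> complex) set" where
  "restrict_I0 X = {\<lambda>u\<in>X. u p |p. p \<in> I0}"

(* For compact X, cfunspace is C(X) with the supremum metric. *)
definition function_algebra_I ::
    "('d::finite, 'n::finite) qpoint set \<Rightarrow> (('d, 'n) qpoint \<Rightarrow> complex) set" where
  "function_algebra_I D = (let X = Qtop closure_of D in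
     mtopology_of (cfunspace (subtopology Qtop X) euclidean_metric) closure_of restrict_I0 X)"

(* The least closed boundary of a function algebra, a closed boundary being a closed set on which
   every function of the algebra attains its maximum modulus. *)
definition shilov_boundary :: "'a topology \<Rightarrow> ('a \<Rightarrow> complex) set \<Rightarrow> 'a set" where
  "shilov_boundary X \<A> =
     \<Inter>{B. closedin X B \<and> (\<forall>f\<in>\<A>. \<exists>x\<in>B. \<forall>y\<in>topspace X. cmod (f y) \<le> cmod (f x))}"

definition bdry :: "('d::finite, 'n::finite) qpoint set \<Rightarrow> ('d, 'n) qpoint set" where
  "bdry D = shilov_boundary (subtopology Qtop (Qtop closure_of D)) (function_algebra_I D)"

section \<open>Reductions and associated bundles\<close>

(* The last two conjuncts say that pi0 induces a homeomorphism from P/K onto X. *)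
definition is_reduction ::
    "('d::finite, 'n::finite) qpoint set \<Rightarrow> ('d, 'n) mtuple set \<Rightarrow> bool" where
  "is_reduction X P \<longleftrightarrow>
     P \<subseteq> Vset \<and> compact P \<and>
     (\<forall>k\<in>unitary_group. \<forall>z\<in>P. conj_tuple k z \<in> P) \<and>
     quotient_map (top_of_set P) (subtopology Qtop X) pi0 \<and>
     (\<forall>z\<in>P. \<forall>w\<in>P. pi0 z = pi0 w \<longrightarrow> (\<exists>k\<in>unitary_group. w = conj_tuple k z))"

type_synonym ('d, 'n) bpoint = "(('d, 'n) mtuple \<times> 'n cmat) set"

definition bclass :: "('d::finite, 'n::finite) mtuple \<Rightarrow> 'n cmat \<Rightarrow> ('d, 'n) bpoint" where
  "bclass z A = {(conj_tuple k z, conj_mat k A) |k. k \<in> unitary_group}"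

definition quotient_topology :: "'a topology \<Rightarrow> ('a \<Rightarrow> 'b) \<Rightarrow> 'b topology" where
  "quotient_topology X q =
     topology (\<lambda>U. U \<subseteq> q ` topspace X \<and> openin X {x \<in> topspace X. q x \<in> U})"

definition total_space :: "('d::finite, 'n::finite) mtuple set \<Rightarrow> ('d, 'n) bpoint topology" where
  "total_space P = quotient_topology (top_of_set (P \<times> UNIV)) (\<lambda>(z, A). bclass z A)"

definition bproj :: "('d::finite, 'n::finite) bpoint \<Rightarrow> ('d, 'n) qpoint" where
  "bproj e = (THE u. \<exists>z A. e = bclass z A \<and> u = pi0 z)"

(* For z in Vset only scalar unitaries fix z, so each class is the graph of a function on the
   K-orbit of z, and two classes in one fibre have representatives with the same first component. *)
definition fibre_op ::
    "('n cmat \<Rightarrow> 'n cmat \<Rightarrow> 'n cmat) \<Rightarrow> ('d::finite, 'n::finite) bpoint \<Rightarrow> ('d, 'n) bpoint \<Rightarrow> ('d, 'n) bpoint"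
where
  "fibre_op h e f = {(z, h A B) |z A B. (z, A) \<in> e \<and> (z, B) \<in> f}"

(* The C*-norm of M_n(C) is the operator norm on C^n with its Euclidean norm. *)
definition fibre_norm :: "('d::finite, 'n::finite) bpoint \<Rightarrow> real" where
  "fibre_norm e = (THE r. \<exists>z A. e = bclass z A \<and> r = onorm (\<lambda>x. A *v x))"

definition tau :: "('d::finite, 'n::finite) bpoint \<Rightarrow> complex" where
  "tau e = (THE t. \<exists>z A. e = bclass z A \<and> t = trace A / of_nat CARD('n))"

section \<open>Continuous sections\<close>

type_synonym ('d, 'n) bsection = "('d, 'n) qpoint \<Rightarrow> ('d, 'n) bpoint"

definition Gamma_c ::
    "('d::finite, 'n::finite) qpoint set \<Rightarrow> ('d, 'n) mtuple set \<Rightarrow> ('d, 'n) bsection set" where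
  "Gamma_c B P = {\<sigma> \<in> extensional B.
     continuous_map (subtopology Qtop B) (total_space P) \<sigma> \<and> (\<forall>u\<in>B. bproj (\<sigma> u) = u)}"

definition sec_mult ::
    "('d::finite, 'n::finite) qpoint set \<Rightarrow> ('d, 'n) bsection \<Rightarrow> ('d, 'n) bsection \<Rightarrow> ('d, 'n) bsection"
where
  "sec_mult B \<sigma> \<rho> = (\<lambda>u\<in>B. fibre_op (**) (\<sigma> u) (\<rho> u))"

definition sec_diff ::
    "('d::finite, 'n::finite) qpoint set \<Rightarrow> ('d, 'n) bsection \<Rightarrow> ('d, 'n) bsection \<Rightarrow> ('d, 'n) bsection"
where
  "sec_diff B \<sigma> \<rho> = (\<lambda>u\<in>B. fibre_op (-) (\<sigma> u) (\<rho> u))"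

definition sec_norm :: "('d::finite, 'n::finite) qpoint set \<Rightarrow> ('d, 'n) bsection \<Rightarrow> real" where
  "sec_norm B \<sigma> = (SUP u\<in>B. fibre_norm (\<sigma> u))"

(* The section with value [z, \<phi> z] at [z] for all z in P; it is meant for functions \<phi> with
   \<phi> (conj_tuple k z) = conj_mat k (\<phi> z), which makes that class depend on [z] only. *)
definition equivariant_section ::
    "('d::finite, 'n::finite) qpoint set \<Rightarrow> ('d, 'n) mtuple set \<Rightarrow> (('d, 'n) mtuple \<Rightarrow> 'n cmat) \<Rightarrow> ('d, 'n) bsection"
where
  "equivariant_section B P \<phi> = (\<lambda>u\<in>B. THE e. \<exists>z\<in>P. pi0 z = u \<and> e = bclass z (\<phi> z))"

definition Psi ::
    "('d::finite, 'n::finite) qpoint set \<Rightarrow> ('d, 'n) mtuple set \<Rightarrow> (('d, 'n) mtuple \<Rightarrow> 'n cmat) \<Rightarrow> ('d, 'n) bsection"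
where
  "Psi D P \<phi> = equivariant_section (bdry D) P \<phi>"

definition tracial_algebra_S ::
    "('d::finite, 'n::finite) qpoint set \<Rightarrow> ('d, 'n) mtuple set \<Rightarrow> ('d, 'n) bsection set" where
  "tracial_algebra_S D P = {\<sigma> \<in> Gamma_c (bdry D) P.
     \<forall>\<epsilon>>0. \<exists>\<phi>\<in>S0. sec_norm (bdry D) (sec_diff (bdry D) \<sigma> (Psi D P \<phi>)) < \<epsilon>}"

section \<open>Center and expectation\<close>

(* The central section c times the identity section. *)
definition scalar_section ::
    "('d::finite, 'n::finite) qpoint set \<Rightarrow> ('d, 'n) mtuple set \<Rightarrow> (('d, 'n) qpoint \<Rightarrow> complex) \<Rightarrow> ('d, 'n) bsection"
where
  "scalar_section B P c = equivariant_section B P (\<lambda>z. mat (c (pi0 z)))"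

definition expectation_T ::
    "('d::finite, 'n::finite) qpoint set \<Rightarrow> ('d, 'n) mtuple set \<Rightarrow> ('d, 'n) bsection \<Rightarrow> ('d, 'n) bsection"
where
  "expectation_T D P \<sigma> = scalar_section (bdry D) P (tau \<circ> \<sigma>)"

(* The function algebra as an algebra of sections, by restriction to the Shilov boundary. *)
definition embedded_I ::
    "('d::finite, 'n::finite) qpoint set \<Rightarrow> ('d, 'n) mtuple set \<Rightarrow> ('d, 'n) bsection set" where
  "embedded_I D P =
     (\<lambda>f. scalar_section (bdry D) P (restrict f (bdry D))) ` function_algebra_I D"

definition sec_center ::
    "('d::finite, 'n::finite) qpoint set \<Rightarrow> ('d, 'n) bsection set \<Rightarrow> ('d, 'n) bsection set" where
  "sec_center B \<S> = {\<sigma> \<in> \<S>. \<forall>\<rho>\<in>\<S>. sec_mult B \<sigma> \<rho> = sec_mult B \<rho> \<sigma>}"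

end

theory Submission
  imports Defs
begin

text \<open>Write \<open>B\<close> for the Shilov boundary. There are two ingredients.

  The first concerns functions. The normalized trace of an element \<open>\<phi>\<close> of the
  trace algebra is an invariant polynomial, and \<open>\<bar>tr M\<bar> / n\<close> is at most the operator
  norm of \<open>M\<close>. So if \<open>\<sigma>\<close> is a norm limit of sections \<open>\<Psi>(\<phi>)\<close>, then \<open>\<tau> \<circ> \<sigma>\<close> is a uniform limit on
  \<open>B\<close> of invariant polynomials. Because every regular function attains its maximum modulus on
  \<open>B\<close>, the limit is uniform on the whole closure of the domain, and \<open>\<tau> \<circ> \<sigma>\<close> is the restriction to
  \<open>B\<close> of an element of the function algebra (\<open>tau_trace_closure\<close>,
  \<open>extend_uniform_limit_from_boundary\<close>). Conversely a scalar section given by an element of the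
  function algebra is a limit of scalar sections given by invariant polynomials, and \<open>T\<close> fixes it.
  This needs the existence theorem for the Shilov boundary, namely that the intersection of all
  closed boundaries is again a closed boundary (\<open>shilov_boundary_closed_boundary\<close>). It is
  proved by a direct compactness argument: if a basic neighbourhood \<open>V\<close> misses some closed
  boundary, then removing \<open>V\<close> from any closed boundary leaves a closed boundary
  (\<open>closed_boundary_remove_basic\<close>).

  The second concerns the fibres. Over a generating tuple only scalar matrices stabilize, so a
  class \<open>[z, A]\<close> determines \<open>A\<close> and the fibre operations are the matrix operations
  (\<open>bclass_inject\<close>, \<open>fibre_op_bclass\<close>). The coordinate sections lie in the tracial function
  algebra and generate every fibre, so a section commuting with them is fibrewise scalar, hence
  equal to its image under \<open>T\<close> (\<open>commutes_with_coordinates_imp_scalar\<close>). Together with the first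
  part this identifies the center.\<close>

section \<open>Conjugation of matrices and tuples\<close>

lemma matrix_inv_unique:
  fixes A B :: "'a::semiring_1^'n^'n"
  assumes "A ** B = mat 1" "B ** A = mat 1"
  shows "matrix_inv A = B"
proof -
  have "A ** matrix_inv A = mat 1 \<and> matrix_inv A ** A = mat 1"
    unfolding matrix_inv_def by (rule someI[of _ B]) (use assms in auto)
  then show ?thesis
    by (metis assms(2) matrix_mul_assoc matrix_mul_lid matrix_mul_rid)
qed

lemma matrix_inv_cancel:
  fixes A :: "'a::semiring_1^'n^'n"
  assumes "invertible A"
  shows "A ** matrix_inv A = mat 1" "matrix_inv A ** A = mat 1"
  using assms matrix_inv_unique unfolding invertible_def by metis+

lemma mat_mult_left_nth: "(mat c ** (A :: 'a::comm_semiring_1^'n^'n)) $ i $ j = c * A $ i $ j"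
  by (simp add: matrix_matrix_mult_def mat_def if_distrib [of "\<lambda>x. x * _"] cong: if_cong)

lemma mat_mult_commute: "mat c ** A = A ** mat c" for A :: "'a::comm_semiring_1^'n^'n"
proof -
  have "(A ** mat c) $ i $ j = c * A $ i $ j" for i j
    by (simp add: matrix_matrix_mult_def mat_def if_distrib mult.commute cong: if_cong)
  then show ?thesis
    by (simp add: vec_eq_iff mat_mult_left_nth)
qed

lemma mat_diff: "mat (c - d) = mat c - mat d" for c d :: "'a::comm_ring_1"
  by (simp add: vec_eq_iff mat_def)

lemma trace_mat: "trace (mat c :: 'a::comm_semiring_1^'n^'n) = of_nat CARD('n) * c"
  by (simp add: trace_def mat_def)

lemma matrix_mult_add_left: "(A + B) ** C = A ** C + B ** (C :: 'a::semiring_1^'n^'m)"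
  by (simp add: vec_eq_iff matrix_matrix_mult_def sum.distrib distrib_right)

lemma conj_mat_add: "conj_mat s (A + B) = conj_mat s A + conj_mat s B"
  by (simp add: conj_mat_def matrix_add_ldistrib matrix_mult_add_left)

lemma conj_mat_diff: "conj_mat s (A - B) = conj_mat s A - conj_mat s B"
  using conj_mat_add[of s "A - B" B] by (simp add: algebra_simps)

lemma conj_mat_mult:
  assumes "invertible s"
  shows "conj_mat s (A ** B) = conj_mat s A ** conj_mat s B"
  unfolding conj_mat_def
  by (metis assms matrix_inv_cancel(1) matrix_mul_assoc matrix_mul_rid)

lemma conj_mat_scalar: "invertible s \<Longrightarrow> conj_mat s (mat c) = mat c"
  unfolding conj_mat_def
  by (metis mat_mult_commute matrix_inv_cancel(2) matrix_mul_assoc matrix_mul_rid)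

lemma trace_conj_mat: "invertible s \<Longrightarrow> trace (conj_mat s A) = trace A"
  unfolding conj_mat_def
  by (metis matrix_inv_cancel(1) matrix_mul_assoc matrix_mul_lid trace_mul_sym)

lemma conj_mat_id: "conj_mat (mat 1) A = A"
  by (simp add: conj_mat_def matrix_inv_unique[of "mat 1" "mat 1"])

lemma conj_mat_conj_mat:
  assumes "invertible s" "invertible t"
  shows "conj_mat s (conj_mat t A) = conj_mat (t ** s) A"
proof -
  have "(t ** s) ** (matrix_inv s ** matrix_inv t) = mat 1"
    by (metis assms matrix_inv_cancel(1) matrix_mul_assoc matrix_mul_lid)
  moreover have "(matrix_inv s ** matrix_inv t) ** (t ** s) = mat 1"
    by (metis assms matrix_inv_cancel(2) matrix_mul_assoc matrix_mul_lid)
  ultimately have "matrix_inv (t ** s) = matrix_inv s ** matrix_inv t"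
    by (rule matrix_inv_unique)
  then show ?thesis
    by (simp add: conj_mat_def matrix_mul_assoc)
qed

lemma conj_tuple_nth [simp]: "conj_tuple s z $ i = conj_mat s (z $ i)"
  by (simp add: conj_tuple_def)

lemma conj_tuple_id: "conj_tuple (mat 1) z = z"
  by (simp add: vec_eq_iff conj_mat_id)

lemma conj_tuple_conj_tuple:
  "invertible s \<Longrightarrow> invertible t \<Longrightarrow> conj_tuple s (conj_tuple t z) = conj_tuple (t ** s) z"
  by (simp add: vec_eq_iff conj_mat_conj_mat)

lemma conj_mat_eq_self_iff:
  assumes "invertible s"
  shows "conj_mat s A = A \<longleftrightarrow> s ** A = A ** s"
  unfolding conj_mat_def
  by (metis assms matrix_inv_cancel matrix_mul_assoc matrix_mul_lid)

section \<open>The commutant of a generating tuple\<close>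

lemma commutes_with_mat_alg:
  assumes "\<And>B. B \<in> S \<Longrightarrow> A ** B = B ** A" and "M \<in> mat_alg S"
  shows "A ** M = M ** A"
  using assms(2)
proof induction
  case (gen M)
  then show ?case by (rule assms(1))
next
  case (scalar c)
  then show ?case by (simp add: mat_mult_commute)
next
  case (add M N)
  then show ?case by (simp add: matrix_add_ldistrib matrix_mult_add_left)
next
  case (mult M N)
  then show ?case by (metis matrix_mul_assoc)
qed

lemma Vset_commutant:
  assumes "z \<in> Vset" and "\<And>i. A ** z $ i = z $ i ** A"
  shows "A ** M = M ** A"
proof (rule commutes_with_mat_alg)
  show "M \<in> mat_alg (range (\<lambda>i. z $ i))"
    using assms(1) by (simp add: Vset_def)
qed (use assms(2) in auto)

lemma commutes_with_all_imp_scalar: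
  fixes A :: "'a::comm_ring_1^'n^'n"
  assumes "\<And>M. A ** M = M ** A"
  obtains c where "A = mat c"
proof -
  define E :: "'n \<Rightarrow> 'n \<Rightarrow> 'a^'n^'n"
    where "E i j = (\<chi> k l. if k = i \<and> l = j then 1 else 0)" for i j
  have L: "(A ** E i j) $ k $ l = (if l = j then A $ k $ i else 0)" for i j k l
    by (simp add: E_def matrix_matrix_mult_def if_distrib cong: if_cong)
  have R: "(E i j ** A) $ k $ l = (if k = i then A $ j $ l else 0)" for i j k l
    by (simp add: E_def matrix_matrix_mult_def if_distrib[of "\<lambda>x. x * _"] cong: if_cong)
  have eq: "(if l = j then A $ k $ i else 0) = (if k = i then A $ j $ l else 0)" for i j k l
    by (metis L R assms)
  have "A $ k $ i = 0" if "k \<noteq> i" for k i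
    using eq[of i i k i] that by simp
  moreover have "A $ i $ i = A $ j $ j" for i j
    using eq[of j j i i] by simp
  ultimately have "A = mat (A $ undefined $ undefined)"
    by (auto simp: vec_eq_iff mat_def)
  then show ?thesis ..
qed

section \<open>Unitary matrices and the operator norm\<close>

lemma cadjoint_nth [simp]: "cadjoint A $ i $ j = cnj (A $ j $ i)"
  by (simp add: cadjoint_def transpose_def)

lemma cadjoint_cadjoint: "cadjoint (cadjoint A) = A"
  by (simp add: vec_eq_iff)

lemma cadjoint_mult: "cadjoint (A ** B) = cadjoint B ** cadjoint A"
  by (simp add: vec_eq_iff matrix_matrix_mult_def mult.commute)

lemma unitary_invertible: "k \<in> unitary_group \<Longrightarrow> invertible k"
  by (auto simp: unitary_group_def invertible_def)

lemma unitary_matrix_inv: "k \<in> unitary_group \<Longrightarrow> matrix_inv k = cadjoint k"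
  by (auto simp: unitary_group_def intro!: matrix_inv_unique)

lemma unitary_one: "mat 1 \<in> unitary_group"
proof -
  have "cadjoint (mat 1) = (mat 1 :: 'n::finite cmat)"
    by (simp add: vec_eq_iff mat_def)
  then show ?thesis by (simp add: unitary_group_def)
qed

lemma unitary_cadjoint: "k \<in> unitary_group \<Longrightarrow> cadjoint k \<in> unitary_group"
  by (simp add: unitary_group_def cadjoint_cadjoint)

lemma unitary_mult: "k \<in> unitary_group \<Longrightarrow> l \<in> unitary_group \<Longrightarrow> k ** l \<in> unitary_group"
  unfolding unitary_group_def mem_Collect_eq cadjoint_mult
  by (metis matrix_mul_assoc matrix_mul_lid)

lemma inner_cadjoint:
  fixes A :: "'n::finite cmat"
  shows "(A *v x) \<bullet> y = x \<bullet> (cadjoint A *v y)"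
proof -
  have "(A *v x) \<bullet> y = (\<Sum>i\<in>UNIV. \<Sum>j\<in>UNIV. (A $ i $ j * x $ j) \<bullet> y $ i)"
    by (simp add: inner_vec_def matrix_vector_mult_def inner_sum_left)
  also have "\<dots> = (\<Sum>j\<in>UNIV. \<Sum>i\<in>UNIV. (A $ i $ j * x $ j) \<bullet> y $ i)"
    by (rule sum.swap)
  also have "\<dots> = (\<Sum>j\<in>UNIV. \<Sum>i\<in>UNIV. x $ j \<bullet> (cnj (A $ i $ j) * y $ i))"
    by (simp add: inner_complex_def algebra_simps)
  also have "\<dots> = x \<bullet> (cadjoint A *v y)"
    by (simp add: inner_vec_def matrix_vector_mult_def inner_sum_right)
  finally show ?thesis .
qed

lemma norm_unitary_mult:
  assumes "k \<in> unitary_group"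
  shows "norm (k *v x) = norm x"
proof -
  have "(k *v x) \<bullet> (k *v x) = x \<bullet> (cadjoint k *v (k *v x))"
    by (rule inner_cadjoint)
  also have "\<dots> = x \<bullet> x"
    using assms by (simp add: matrix_vector_mul_assoc unitary_group_def)
  finally show ?thesis
    by (simp add: norm_eq_sqrt_inner)
qed

lemma onorm_conj_unitary:
  fixes A :: "'n::finite cmat"
  assumes "k \<in> unitary_group"
  shows "onorm (\<lambda>x. conj_mat k A *v x) = onorm (\<lambda>x. A *v x)"
proof -
  have le: "onorm (\<lambda>x. conj_mat k A *v x) \<le> onorm (\<lambda>x. A *v x)"
    if k: "k \<in> unitary_group" for k A :: "'n cmat"
  proof (rule onorm_bound)
    show "0 \<le> onorm (\<lambda>x. A *v x)"
      by (rule onorm_pos_le) simp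
    fix x
    have "norm (conj_mat k A *v x) = norm (cadjoint k *v (A *v (k *v x)))"
      by (simp add: conj_mat_def unitary_matrix_inv[OF k] matrix_vector_mul_assoc matrix_mul_assoc)
    also have "\<dots> = norm (A *v (k *v x))"
      by (rule norm_unitary_mult[OF unitary_cadjoint[OF k]])
    also have "\<dots> \<le> onorm (\<lambda>x. A *v x) * norm (k *v x)"
      by (rule onorm) simp
    also have "norm (k *v x) = norm x"
      by (rule norm_unitary_mult[OF k])
    finally show "norm (conj_mat k A *v x) \<le> onorm (\<lambda>x. A *v x) * norm x" .
  qed
  have "conj_mat (cadjoint k) (conj_mat k A) = A"
    using assms unitary_cadjoint[OF assms]
    by (simp add: conj_mat_conj_mat unitary_invertible conj_mat_id unitary_group_def)
  then show ?thesis
    using le[OF assms, of A] le[OF unitary_cadjoint[OF assms], of "conj_mat k A"] by simp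
qed

lemma onorm_matrix_diff_le:
  fixes A B :: "'n::finite cmat"
  shows "onorm (\<lambda>x. (A - B) *v x) \<le> onorm (\<lambda>x. A *v x) + onorm (\<lambda>x. B *v x)"
  using onorm_triangle[of "\<lambda>x. A *v x" "\<lambda>x. - (B *v x)"]
  by (simp add: matrix_vector_mult_diff_rdistrib onorm_neg bounded_linear_minus)

lemma onorm_matrix_le_norm:
  fixes A :: "'n::finite cmat"
  shows "onorm (\<lambda>x. A *v x) \<le> real (CARD('n)) * (real (CARD('n)) * norm A)"
proof (rule onorm_bound)
  fix x :: "complex^'n"
  have ent: "norm (A $ i $ j * x $ j) \<le> norm A * norm x" for i j
  proof -
    have "norm (A $ i $ j) \<le> norm A"
      using Finite_Cartesian_Product.norm_nth_le[of "A $ i" j]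
        Finite_Cartesian_Product.norm_nth_le[of A i] by linarith
    moreover have "norm (x $ j) \<le> norm x"
      by (rule Finite_Cartesian_Product.norm_nth_le)
    ultimately show ?thesis
      by (simp add: norm_mult mult_mono)
  qed
  have row: "norm ((A *v x) $ i) \<le> real CARD('n) * (norm A * norm x)" for i
    using sum_norm_le[of UNIV "\<lambda>j. A $ i $ j * x $ j" "\<lambda>_. norm A * norm x"] ent
    by (simp add: matrix_vector_mult_def)
  have "norm (A *v x) \<le> (\<Sum>i\<in>UNIV. norm ((A *v x) $ i))"
    unfolding norm_vec_def by (rule L2_set_le_sum) simp
  also have "\<dots> \<le> (\<Sum>i\<in>(UNIV :: 'n set). real CARD('n) * (norm A * norm x))"
    by (rule sum_mono) (rule row)
  finally show "norm (A *v x) \<le> real CARD('n) * (real CARD('n) * norm A) * norm x"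
    by (simp add: mult.assoc)
qed simp

lemma continuous_on_onorm_matrix:
  "continuous_on UNIV (\<lambda>A :: 'n::finite cmat. onorm (\<lambda>x. A *v x))"
proof -
  define C where "C = real CARD('n) * real CARD('n)"
  have one: "onorm (\<lambda>x. A *v x) - onorm (\<lambda>x. B *v x) \<le> C * norm (A - B)" for A B :: "'n cmat"
  proof -
    have "onorm (\<lambda>x. A *v x) = onorm (\<lambda>x. (A - B) *v x + B *v x)"
      by (simp add: matrix_vector_mult_diff_rdistrib)
    also have "\<dots> \<le> onorm (\<lambda>x. (A - B) *v x) + onorm (\<lambda>x. B *v x)"
      by (rule onorm_triangle) auto
    finally show ?thesis
      using onorm_matrix_le_norm[of "A - B"] by (simp add: C_def mult.assoc)
  qed
  have "dist (onorm (\<lambda>x. A *v x)) (onorm (\<lambda>x. B *v x)) \<le> C * dist A B" for A B :: "'n cmat"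
    using one[of A B] one[of B A] by (simp add: dist_norm norm_minus_commute abs_le_iff)
  then have "C-lipschitz_on UNIV (\<lambda>A :: 'n cmat. onorm (\<lambda>x. A *v x))"
    by (simp add: lipschitz_on_def C_def)
  then show ?thesis
    by (rule lipschitz_on_continuous_on)
qed

lemma cmod_trace_le_onorm:
  fixes A :: "'n::finite cmat"
  shows "cmod (trace A) \<le> real CARD('n) * onorm (\<lambda>x. A *v x)"
proof -
  have "cmod (A $ i $ i) \<le> onorm (\<lambda>x. A *v x)" for i
  proof -
    have "A $ i $ i = (A *v axis i 1) $ i"
      by (simp add: matrix_vector_mult_def axis_def if_distrib cong: if_cong)
    also have "cmod \<dots> \<le> norm (A *v axis i 1)"
      by (rule Finite_Cartesian_Product.norm_nth_le)
    also have "\<dots> \<le> onorm (\<lambda>x. A *v x) * norm (axis i (1::complex) :: complex^'n)"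
      by (rule onorm) simp
    finally show ?thesis by simp
  qed
  then show ?thesis
    unfolding trace_def by (rule order_trans[OF norm_sum sum_bounded_above]) 
qed

lemma onorm_mat_le: "onorm (\<lambda>x. (mat c :: 'n::finite cmat) *v x) \<le> cmod c"
proof (rule onorm_bound)
  fix x :: "complex^'n"
  have "mat c *v x = (\<chi> i. c * x $ i)"
    by (simp add: vec_eq_iff matrix_vector_mult_def mat_def if_distrib[of "\<lambda>y. y * _"] cong: if_cong)
  then show "norm (mat c *v x) \<le> cmod c * norm x"
    by (simp add: norm_vec_def norm_mult L2_set_right_distrib)
qed simp

section \<open>Invariant polynomials and the trace algebra\<close>

lemma poly_funs_sum:
  assumes "finite J" "\<And>j. j \<in> J \<Longrightarrow> f j \<in> poly_funs"
  shows "(\<lambda>z. \<Sum>j\<in>J. f j z) \<in> poly_funs"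
  using assms by (induction J) (auto intro: poly_funs.intros)

lemma continuous_on_poly_funs:
  assumes "p \<in> poly_funs"
  shows "continuous_on UNIV p"
  using assms by induction (auto intro!: continuous_intros)

lemma I0_const: "(\<lambda>z. c) \<in> I0"
  by (simp add: I0_def poly_funs.const)

lemma I0_add: "p \<in> I0 \<Longrightarrow> q \<in> I0 \<Longrightarrow> (\<lambda>z. p z + q z) \<in> I0"
  by (simp add: I0_def poly_funs.add)

lemma I0_mult: "p \<in> I0 \<Longrightarrow> q \<in> I0 \<Longrightarrow> (\<lambda>z. p z * q z) \<in> I0"
  by (simp add: I0_def poly_funs.mult)

lemma I0_diff: "p \<in> I0 \<Longrightarrow> q \<in> I0 \<Longrightarrow> (\<lambda>z. p z - q z) \<in> I0"
  using I0_add[of p "\<lambda>z. (- 1) * q z"] I0_mult[OF I0_const[of "- 1"], of q] by simp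

lemma I0_invariant: "p \<in> I0 \<Longrightarrow> invertible s \<Longrightarrow> p (conj_tuple s z) = p z"
  by (simp add: I0_def)

lemma mat_fun_alg_entry:
  fixes S :: "(('d::finite, 'n::finite) mtuple \<Rightarrow> 'n cmat) set"
  assumes "\<phi> \<in> mat_fun_alg S" and "\<And>f a b. f \<in> S \<Longrightarrow> (\<lambda>z. f z $ a $ b) \<in> poly_funs"
  shows "(\<lambda>z. \<phi> z $ a $ b) \<in> poly_funs"
  using assms(1)
proof (induction arbitrary: a b)
  case (gen f)
  then show ?case by (rule assms(2))
next
  case (scalar c)
  show ?case by (simp add: poly_funs.const)
next
  case (add f g)
  then show ?case by (simp add: poly_funs.add)
next
  case (mult f g)
  then show ?case
    by (auto simp: matrix_matrix_mult_def intro!: poly_funs_sum poly_funs.mult)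
qed

lemma mat_fun_alg_equivariant:
  fixes S :: "(('d::finite, 'n::finite) mtuple \<Rightarrow> 'n cmat) set"
  assumes "\<phi> \<in> mat_fun_alg S" and s: "invertible s"
    and "\<And>f. f \<in> S \<Longrightarrow> f (conj_tuple s z) = conj_mat s (f z)"
  shows "\<phi> (conj_tuple s z) = conj_mat s (\<phi> z)"
  using assms(1)
proof induction
  case (gen f)
  then show ?case by (rule assms(3))
next
  case (scalar c)
  show ?case by (simp add: conj_mat_scalar s)
next
  case (add f g)
  then show ?case by (simp add: conj_mat_add)
next
  case (mult f g)
  then show ?case by (simp add: conj_mat_mult s)
qed

lemma S0_entry:
  fixes \<phi> :: "('d::finite, 'n::finite) mtuple \<Rightarrow> 'n cmat"
  assumes "\<phi> \<in> S0"
  shows "(\<lambda>z. \<phi> z $ a $ b) \<in> poly_funs"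
proof -
  have G: "(\<lambda>z. f z $ a $ b) \<in> poly_funs" if "f \<in> G0" for f :: "('d, 'n) mtuple \<Rightarrow> 'n cmat" and a b
    using that unfolding G0_def by (rule mat_fun_alg_entry) (auto intro: poly_funs.coord)
  have I: "(\<lambda>z. mat (p z) $ a $ b) \<in> poly_funs" if "p \<in> I0" for p :: "('d, 'n) mtuple \<Rightarrow> complex" and a b
    using that by (cases "a = b") (auto simp: mat_def I0_def intro: poly_funs.const)
  show ?thesis
    using assms unfolding S0_def by (rule mat_fun_alg_entry) (auto intro: G I)
qed

lemma S0_equivariant:
  assumes "\<phi> \<in> S0" "invertible s"
  shows "\<phi> (conj_tuple s z) = conj_mat s (\<phi> z)"
proof -
  have G: "f (conj_tuple s z) = conj_mat s (f z)" if "f \<in> G0" for f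
    using that assms(2) unfolding G0_def by (rule mat_fun_alg_equivariant) auto
  show ?thesis
    using assms unfolding S0_def
    by (rule mat_fun_alg_equivariant)
      (auto simp: G I0_invariant conj_mat_scalar assms(2))
qed

lemma S0_coord: "(\<lambda>z. z $ i) \<in> S0"
  unfolding S0_def G0_def by (intro mat_fun_alg.gen UnI1) auto

lemma S0_scalar: "p \<in> I0 \<Longrightarrow> (\<lambda>z. mat (p z)) \<in> S0"
  unfolding S0_def by (intro mat_fun_alg.gen UnI2) auto

lemma continuous_on_S0:
  assumes "\<phi> \<in> S0"
  shows "continuous_on UNIV \<phi>"
proof -
  have "continuous_on UNIV (\<lambda>z. \<chi> a b. \<phi> z $ a $ b)"
    by (intro continuous_on_vec_lambda continuous_on_poly_funs S0_entry assms)
  then show ?thesis by simp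
qed

lemma normalized_trace_S0:
  fixes \<phi> :: "('d::finite, 'n::finite) mtuple \<Rightarrow> 'n cmat"
  assumes "\<phi> \<in> S0"
  shows "(\<lambda>z. trace (\<phi> z) / of_nat CARD('n)) \<in> I0"
proof -
  have "(\<lambda>z. trace (\<phi> z) * (1 / of_nat CARD('n))) \<in> poly_funs"
    unfolding trace_def
    by (intro poly_funs.mult poly_funs.const poly_funs_sum S0_entry[OF assms]) simp
  then show ?thesis
    using S0_equivariant[OF assms] by (simp add: I0_def trace_conj_mat)
qed

section \<open>Existence of the Shilov boundary\<close>

text \<open>A closed boundary for a set \<open>A\<close> of functions on \<open>X\<close>: a closed set on which every function
  of \<open>A\<close> attains its maximum modulus. The Shilov boundary is by definition the intersection of all
  of them.\<close>

definition closed_boundary :: "'a topology \<Rightarrow> ('a \<Rightarrow> complex) set \<Rightarrow> 'a set \<Rightarrow> bool" where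
  "closed_boundary X A B \<longleftrightarrow>
     closedin X B \<and> (\<forall>f\<in>A. \<exists>x\<in>B. \<forall>y\<in>topspace X. cmod (f y) \<le> cmod (f x))"

lemma shilov_boundary_eq: "shilov_boundary X A = \<Inter>{B. closed_boundary X A B}"
  by (simp add: shilov_boundary_def closed_boundary_def)

lemma compactin_attains_max_cmod:
  assumes "compactin X S" "S \<noteq> {}" "continuous_map X euclidean f"
  obtains x where "x \<in> S" "\<And>y. y \<in> S \<Longrightarrow> cmod (f y) \<le> cmod (f x)"
proof -
  have "compactin euclidean ((\<lambda>x. cmod (f x)) ` S)"
    by (intro image_compactin[OF assms(1)] continuous_map_norm assms(3))
  then show thesis
    using compact_attains_sup[of "(\<lambda>x. cmod (f x)) ` S"] assms(2) that by auto
qed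

text \<open>The properties of a function algebra on a compact space that the existence of the Shilov
  boundary depends on; functions are extensional on \<open>X\<close>. The last assumption says that the
  topology of \<open>X\<close> is the weak topology of \<open>A\<close>, which for a compact Hausdorff space expresses that
  \<open>A\<close> separates points. Closure under sums enters only through it, in the possibility of
  choosing the functions \<open>f\<close> to vanish at \<open>x\<close>.\<close>

locale function_alg =
  fixes X :: "'a topology" and A :: "('a \<Rightarrow> complex) set"
  assumes compact: "compact_space X" and nonempty: "topspace X \<noteq> {}"
    and continuous: "f \<in> A \<Longrightarrow> continuous_map X euclidean f"
    and const: "(\<lambda>x\<in>topspace X. c) \<in> A"
    and mult: "f \<in> A \<Longrightarrow> g \<in> A \<Longrightarrow> (\<lambda>x\<in>topspace X. f x * g x) \<in> A"
    and weak: "openin X U \<Longrightarrow> x \<in> U \<Longrightarrow>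
      \<exists>F. finite F \<and> F \<subseteq> A \<and> (\<forall>f\<in>F. f x = 0) \<and> (\<forall>y\<in>topspace X. (\<forall>f\<in>F. cmod (f y) < 1) \<longrightarrow> y \<in> U)"
begin

lemma closed_boundary_topspace: "closed_boundary X A (topspace X)"
  unfolding closed_boundary_def
  using compactin_attains_max_cmod[of X "topspace X"] compact nonempty continuous
  by (metis closedin_topspace compact_space_def)

lemma power: "f \<in> A \<Longrightarrow> (\<lambda>x\<in>topspace X. f x ^ m) \<in> A"
proof (induction m)
  case 0
  show ?case using const[of 1] by (simp only: power_0)
next
  case (Suc m)
  have "(\<lambda>x\<in>topspace X. f x * (\<lambda>x\<in>topspace X. f x ^ m) x) \<in> A"
    using Suc by (intro mult) auto
  then show ?case by (simp add: restrict_def cong: if_cong)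
qed

text \<open>If a closed set \<open>S\<close> is not a boundary, some function is too large off \<open>S\<close>; it is normalized
  here to have maximum modulus \<open>1\<close>, and by compactness it stays away from \<open>1\<close> on \<open>S\<close>.\<close>

lemma not_closed_boundary_peak:
  assumes S: "closedin X S" and nb: "\<not> closed_boundary X A S"
  obtains f r where "f \<in> A" "r < 1" "\<And>y. y \<in> S \<Longrightarrow> cmod (f y) \<le> r" "0 \<le> r"
    "\<And>y. y \<in> topspace X \<Longrightarrow> cmod (f y) \<le> 1" "\<exists>y\<in>topspace X. cmod (f y) = 1"
proof (cases "S = {}")
  case True
  obtain y where y: "y \<in> topspace X"
    using nonempty by blast
  show thesis
  proof (rule that[of "\<lambda>x\<in>topspace X. 1" 0])
    show "\<exists>y\<in>topspace X. cmod ((\<lambda>x\<in>topspace X. 1) y) = 1"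
      using y by auto
  qed (use const[of 1] True in simp_all)
next
  case False
  obtain f where f: "f \<in> A" and nf: "\<And>x. x \<in> S \<Longrightarrow> \<exists>y\<in>topspace X. cmod (f x) < cmod (f y)"
    using nb S by (force simp: closed_boundary_def not_le)
  obtain x0 where x0: "x0 \<in> topspace X" "\<And>y. y \<in> topspace X \<Longrightarrow> cmod (f y) \<le> cmod (f x0)"
    using compactin_attains_max_cmod[of X "topspace X" f] compact nonempty continuous[OF f]
    by (auto simp: compact_space_def)
  have "compactin X S"
    using S compact closedin_compact_space by blast
  then obtain x1 where x1: "x1 \<in> S" "\<And>y. y \<in> S \<Longrightarrow> cmod (f y) \<le> cmod (f x1)"
    using compactin_attains_max_cmod[of X S f] False continuous[OF f] by blast
  have lt: "cmod (f x1) < cmod (f x0)"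
    using nf[OF x1(1)] x0(2) by force
  then have pos: "cmod (f x0) > 0"
    by (meson norm_ge_zero order_le_less_trans)
  let ?g = "\<lambda>x\<in>topspace X. inverse (f x0) * f x"
  have "(\<lambda>x\<in>topspace X. (\<lambda>x\<in>topspace X. inverse (f x0)) x * f x) \<in> A"
    by (intro mult const f)
  then have g: "?g \<in> A"
    by (simp add: restrict_def cong: if_cong)
  have gx: "cmod (?g y) = cmod (f y) / cmod (f x0)" if "y \<in> topspace X" for y
    using that by (simp add: norm_mult norm_inverse divide_inverse)
  show thesis
  proof (rule that[of ?g "cmod (f x1) / cmod (f x0)"])
    show "cmod (?g y) \<le> cmod (f x1) / cmod (f x0)" if "y \<in> S" for y
      using gx[of y] x1(2)[OF that] that closedin_subset[OF S] pos
      by (auto simp: divide_right_mono)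
    show "\<exists>y\<in>topspace X. cmod (?g y) = 1"
      by (rule bexI[OF _ x0(1)], subst gx[OF x0(1)]) (use pos in simp)
    show "cmod (?g y) \<le> 1" if "y \<in> topspace X" for y
      using gx[of y] x0(2)[OF that] that pos by (simp add: divide_le_eq_1)
  qed (use g lt pos in auto)
qed

text \<open>If \<open>S - V\<close> were not a boundary, a function \<open>g\<close> of maximum modulus \<open>1\<close> would be smaller than
  \<open>1\<close> there. For a large power \<open>m\<close> every \<open>f g\<^sup>m\<close> with \<open>f\<close> in \<open>F\<close> then has modulus less than \<open>1\<close> on
  \<open>S\<close>: off \<open>V\<close> because of \<open>g\<^sup>m\<close>, on \<open>V\<close> because of \<open>f\<close>. As \<open>S\<close> is a boundary, the same holds on
  \<open>X\<close>, so that \<open>\<bar>f\<bar> < 1\<close> wherever \<open>\<bar>g\<bar> = 1\<close>. Hence \<open>g\<close> attains its maximum modulus only in \<open>V\<close>,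
  and \<open>V\<close> meets every boundary.\<close>

lemma closed_boundary_remove_basic:
  assumes F: "finite F" "F \<subseteq> A"
    and V: "V = {y \<in> topspace X. \<forall>f\<in>F. cmod (f y) < 1}"
    and B: "closed_boundary X A B" "B \<inter> V = {}"
    and S: "closed_boundary X A S"
  shows "closed_boundary X A (S - V)"
proof (rule ccontr)
  assume nb: "\<not> closed_boundary X A (S - V)"
  have "openin X {y \<in> topspace X. cmod (f y) < 1}" if "f \<in> F" for f
  proof -
    have "continuous_map X euclidean (\<lambda>x. cmod (f x))"
      using that F continuous by (intro continuous_map_norm) auto
    from openin_continuous_map_preimage[OF this, of "{..<1}"] show ?thesis by simp
  qed
  then have "openin X (topspace X \<inter> (\<Inter>f\<in>F. {y \<in> topspace X. cmod (f y) < 1}))"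
    using F(1) by (intro openin_Int_Inter) auto
  moreover have "topspace X \<inter> (\<Inter>f\<in>F. {y \<in> topspace X. cmod (f y) < 1}) = V"
    using V by auto
  ultimately have "openin X V" by simp
  then have SV: "closedin X (S - V)"
    using S by (simp add: closed_boundary_def closedin_diff)
  obtain g r where g: "g \<in> A" and r: "r < 1" "0 \<le> r" and gr: "\<And>y. y \<in> S - V \<Longrightarrow> cmod (g y) \<le> r"
    and g1: "\<And>y. y \<in> topspace X \<Longrightarrow> cmod (g y) \<le> 1"
    and gmax: "\<exists>y\<in>topspace X. cmod (g y) = 1"
    using not_closed_boundary_peak[OF SV nb] by metis
  have "\<exists>M. \<forall>y\<in>topspace X. cmod (f y) \<le> M" if "f \<in> F" for f
    using compactin_attains_max_cmod[of X "topspace X" f] compact nonempty that F(2) continuous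
    by (metis compact_space_def subsetD)
  then obtain M where M: "\<And>f y. f \<in> F \<Longrightarrow> y \<in> topspace X \<Longrightarrow> cmod (f y) \<le> M f"
    by metis
  define C where "C = 1 + (\<Sum>f\<in>F. \<bar>M f\<bar>)"
  have C0: "C > 0"
    unfolding C_def by (intro add_pos_nonneg sum_nonneg) auto
  have C: "cmod (f y) \<le> C" if "f \<in> F" "y \<in> topspace X" for f y
    using M[OF that] member_le_sum[of f F "\<lambda>f. \<bar>M f\<bar>"] F(1) that(1) by (auto simp: C_def)
  obtain m where m: "r ^ m < inverse C"
    using real_arch_pow_inv[of "inverse C" r] C0 r by auto
  have small: "cmod (f y) < 1" if f: "f \<in> F" and y: "y \<in> topspace X" "cmod (g y) = 1" for f y
  proof -
    let ?h = "\<lambda>x\<in>topspace X. f x * (\<lambda>x\<in>topspace X. g x ^ m) x"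
    have "?h \<in> A"
      using f F(2) by (intro mult power g) auto
    then obtain x where x: "x \<in> S" "\<And>y. y \<in> topspace X \<Longrightarrow> cmod (?h y) \<le> cmod (?h x)"
      using S unfolding closed_boundary_def by meson
    have xX: "x \<in> topspace X"
      using x(1) S closedin_subset unfolding closed_boundary_def by blast
    have hx: "cmod (?h x) = cmod (f x) * cmod (g x) ^ m"
      using xX by (simp add: norm_mult norm_power)
    have "cmod (?h x) < 1"
    proof (cases "x \<in> V")
      case True
      then have "cmod (f x) < 1" using V f by auto
      moreover have "cmod (g x) ^ m \<le> 1" using g1[OF xX] by (simp add: power_le_one)
      ultimately show ?thesis
        unfolding hx by (metis mult_right_le_one_le norm_ge_zero order_le_less_trans zero_le_power)
    next
      case False
      then have "cmod (g x) ^ m \<le> r ^ m"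
        using gr x(1) by (intro power_mono) auto
      then have "cmod (?h x) \<le> C * r ^ m"
        unfolding hx using C[OF f xX] C0 by (intro mult_mono) auto
      also have "\<dots> < 1"
        using m C0 by (simp add: field_simps)
      finally show ?thesis .
    qed
    moreover have "cmod (?h y) = cmod (f y)"
      using y by (simp add: norm_mult norm_power)
    ultimately show ?thesis
      using x(2)[OF y(1)] by linarith
  qed
  obtain x where "x \<in> B" and x: "\<And>y. y \<in> topspace X \<Longrightarrow> cmod (g y) \<le> cmod (g x)"
    using B(1) g unfolding closed_boundary_def by meson
  have xX: "x \<in> topspace X"
    using \<open>x \<in> B\<close> B(1) closedin_subset unfolding closed_boundary_def by blast
  have "cmod (g x) = 1"
    using gmax x g1[OF xX] by (metis order_antisym)
  then have "x \<in> V"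
    using small xX V by auto
  then show False
    using B(2) \<open>x \<in> B\<close> by blast
qed

text \<open>Otherwise the compact set on which \<open>\<bar>f\<bar>\<close> is maximal would be disjoint from the intersection of
  all closed boundaries, hence covered by finitely many open sets that can be removed from \<open>X\<close> one
  after the other without losing the boundary property.\<close>

theorem shilov_boundary_closed_boundary: "closed_boundary X A (shilov_boundary X A)"
  unfolding closed_boundary_def
proof (intro conjI ballI)
  let ?E = "shilov_boundary X A"
  show E: "closedin X ?E"
    unfolding shilov_boundary_eq
    using closed_boundary_topspace by (intro closedin_Inter) (auto simp: closed_boundary_def)
  fix f assume f: "f \<in> A"
  show "\<exists>x\<in>?E. \<forall>y\<in>topspace X. cmod (f y) \<le> cmod (f x)"
  proof (rule ccontr)
    assume no: "\<not> ?thesis"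
    obtain x0 where x0: "x0 \<in> topspace X" "\<And>y. y \<in> topspace X \<Longrightarrow> cmod (f y) \<le> cmod (f x0)"
      using compactin_attains_max_cmod[of X "topspace X" f] compact nonempty continuous[OF f]
      by (auto simp: compact_space_def)
    define K where "K = {y \<in> topspace X. cmod (f y) \<in> {cmod (f x0)..}}"
    have "closedin X K"
      unfolding K_def
      by (rule closedin_continuous_map_preimage[of _ euclideanreal])
         (use continuous_map_norm[OF continuous[OF f]] in auto)
    then have K: "compactin X K"
      using compact closedin_compact_space by blast
    define W where "W = {V. openin X V \<and> (\<forall>S. closed_boundary X A S \<longrightarrow> closed_boundary X A (S - V))}"
    have "\<exists>V\<in>W. y \<in> V" if "y \<in> K" for y
    proof -
      have y: "y \<in> topspace X" "y \<notin> ?E"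
        using that no x0(2) by (auto simp: K_def) (meson order_trans)
      then obtain B where B: "closed_boundary X A B" "y \<notin> B"
        by (auto simp: shilov_boundary_eq)
      have "openin X (topspace X - B)" "y \<in> topspace X - B"
        using B y by (auto simp: closed_boundary_def)
      then obtain F where F: "finite F" "F \<subseteq> A" "\<forall>f\<in>F. f y = 0"
        "\<forall>u\<in>topspace X. (\<forall>f\<in>F. cmod (f u) < 1) \<longrightarrow> u \<in> topspace X - B"
        using weak by meson
      define V where "V = {y \<in> topspace X. \<forall>f\<in>F. cmod (f y) < 1}"
      have BV: "B \<inter> V = {}"
        using F(4) by (auto simp: V_def)
      have "closed_boundary X A (S - V)" if "closed_boundary X A S" for S
        by (rule closed_boundary_remove_basic[OF F(1,2) V_def B(1) BV that])
      moreover have "openin X V"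
      proof -
        \<comment> \<open>\<open>topspace X - V\<close> is itself a closed boundary.\<close>
        have "closedin X (topspace X - V)"
          using calculation[OF closed_boundary_topspace] by (simp add: closed_boundary_def)
        then show ?thesis
          by (simp add: openin_closedin_eq V_def) 
      qed
      moreover have "y \<in> V"
        unfolding V_def
      proof (intro CollectI conjI ballI)
        fix f assume "f \<in> F"
        then have "f y = 0" using F(3) by blast
        then show "cmod (f y) < 1" by simp
      qed (rule y(1))
      ultimately show ?thesis
        unfolding W_def by blast
    qed
    then have "K \<subseteq> \<Union>W" by blast
    moreover have "\<And>V. V \<in> W \<Longrightarrow> openin X V" by (simp add: W_def)
    ultimately obtain W' where W': "finite W'" "W' \<subseteq> W" "K \<subseteq> \<Union>W'"
      using K unfolding compactin_def by meson
    have "closed_boundary X A (topspace X - \<Union>W')"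
      using W'(1,2)
    proof induction
      case empty
      show ?case using closed_boundary_topspace by simp
    next
      case (insert V W')
      then have "closed_boundary X A ((topspace X - \<Union>W') - V)"
        by (auto simp: W_def)
      moreover have "(topspace X - \<Union>W') - V = topspace X - \<Union>(insert V W')" by blast
      ultimately show ?case by simp
    qed
    then obtain x where "x \<in> topspace X - \<Union>W'" "\<forall>y\<in>topspace X. cmod (f y) \<le> cmod (f x)"
      using f unfolding closed_boundary_def by meson
    then show False
      using W'(3) x0(1) by (auto simp: K_def)
  qed
qed

end

section \<open>Regular functions on the quotient and the function algebra\<close>

lemma pi0_apply: "p \<in> I0 \<Longrightarrow> pi0 z p = p z"
  by (simp add: pi0_def)

lemma pi0_conj: "invertible s \<Longrightarrow> pi0 (conj_tuple s z) = pi0 z"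
  unfolding pi0_def by (rule restrict_ext) (simp add: I0_invariant)

lemma Qset_extensional: "Qset \<subseteq> extensional I0"
  unfolding Qset_def by (rule Collect_subset)

lemma topspace_Qtop: "topspace Qtop = Qset"
  using Qset_extensional by (auto simp: Qtop_def PiE_def)

lemma Qset_const: "u \<in> Qset \<Longrightarrow> u (\<lambda>z. c) = c"
  unfolding Qset_def mem_Collect_eq by (elim conjE) (rule spec)

lemma Qset_add:
  assumes "u \<in> Qset" "p \<in> I0" "q \<in> I0"
  shows "u (\<lambda>z. p z + q z) = u p + u q"
proof -
  have "\<forall>p\<in>I0. \<forall>q\<in>I0. u (\<lambda>z. p z + q z) = u p + u q"
    using assms(1) unfolding Qset_def mem_Collect_eq by (elim conjE)
  from bspec[OF bspec[OF this assms(2)] assms(3)] show ?thesis .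
qed

lemma Qset_mult:
  assumes "u \<in> Qset" "p \<in> I0" "q \<in> I0"
  shows "u (\<lambda>z. p z * q z) = u p * u q"
proof -
  have "\<forall>p\<in>I0. \<forall>q\<in>I0. u (\<lambda>z. p z * q z) = u p * u q"
    using assms(1) unfolding Qset_def mem_Collect_eq by (elim conjE)
  from bspec[OF bspec[OF this assms(2)] assms(3)] show ?thesis .
qed

lemma Qset_diff:
  assumes "u \<in> Qset" "p \<in> I0" "q \<in> I0"
  shows "u (\<lambda>z. p z - q z) = u p - u q"
  using Qset_add[OF assms(1) I0_diff[OF assms(2,3)] assms(3)] by simp

lemma continuous_map_eval:
  assumes "p \<in> I0"
  shows "continuous_map Qtop euclidean (\<lambda>u. u p)"
  unfolding Qtop_def
  by (intro continuous_map_from_subtopology continuous_map_product_projection assms)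

text \<open>The topology of the quotient is the topology of pointwise convergence on the invariant
  polynomials; this is a basic neighbourhood, with a single radius for finitely many polynomials.\<close>

lemma Qtop_weak_nbhd:
  assumes "openin Qtop U" "u \<in> U"
  obtains J e where "finite J" "J \<subseteq> I0" "e > 0"
    "\<forall>v\<in>Qset. (\<forall>p\<in>J. cmod (v p - u p) < e) \<longrightarrow> v \<in> U"
proof -
  obtain T where T: "openin (product_topology (\<lambda>p. euclidean) I0) T" and UT: "U = T \<inter> Qset"
    using assms(1) unfolding Qtop_def openin_subtopology by blast
  obtain Y where Y: "finite {p \<in> I0. Y p \<noteq> (UNIV :: complex set)}" "\<And>p. p \<in> I0 \<Longrightarrow> open (Y p)"
    "u \<in> PiE I0 Y" "PiE I0 Y \<subseteq> T"
    using T assms(2) UT unfolding openin_product_topology_alt by fastforce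
  let ?J = "{p \<in> I0. Y p \<noteq> UNIV}"
  have "\<forall>p\<in>?J. \<exists>r>0. ball (u p) r \<subseteq> Y p"
  proof
    fix p assume "p \<in> ?J"
    then have "open (Y p)" "u p \<in> Y p"
      using Y(2,3) PiE_mem by blast+
    then show "\<exists>r>0. ball (u p) r \<subseteq> Y p"
      unfolding open_contains_ball by (rule bspec)
  qed
  from bchoice[OF this] obtain r where r: "\<forall>p\<in>?J. r p > 0 \<and> ball (u p) (r p) \<subseteq> Y p" ..
  \<comment> \<open>The \<open>1\<close> keeps the set nonempty when there is no restricted coordinate.\<close>
  define e where "e = Min (insert 1 (r ` ?J))"
  have fin: "finite (insert 1 (r ` ?J))"
    using Y(1) by (intro finite.insertI finite_imageI)
  have "\<forall>a\<in>insert 1 (r ` ?J). 0 < a"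
    using r zero_less_one by blast
  then have e: "e > 0"
    unfolding e_def by (subst Min_gr_iff[OF fin]) blast+
  have er: "e \<le> r p" if "p \<in> ?J" for p
    unfolding e_def by (rule Min_le[OF fin insertI2[OF imageI[OF that]]])
  show thesis
  proof (rule that[OF Y(1) _ e], fastforce, intro ballI impI)
    fix v assume v: "v \<in> Qset" "\<forall>p\<in>?J. cmod (v p - u p) < e"
    have "v p \<in> Y p" if "p \<in> I0" for p
    proof (cases "Y p = UNIV")
      case False
      with that have p: "p \<in> ?J" by simp
      have "v p \<in> ball (u p) (r p)"
        using bspec[OF v(2) p] er[OF p] by (simp add: dist_norm norm_minus_commute)
      then show ?thesis using r p by blast
    qed simp
    moreover have "v \<in> extensional I0"
      using v(1) Qset_extensional by blast
    ultimately have "v \<in> PiE I0 Y"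
      by (intro PiE_I) (auto simp: extensional_def)
    then show "v \<in> U"
      using Y(4) v(1) UT by blast
  qed
qed

text \<open>The elements of the function algebra, without reference to the metric space of
  continuous functions.\<close>

lemma mem_closure_restrict_I0:
  fixes X :: "('d::finite, 'n::finite) qpoint set"
  assumes X: "compactin Qtop X"
  defines "C \<equiv> cfunspace (subtopology Qtop X) euclidean_metric"
  shows "f \<in> mtopology_of C closure_of restrict_I0 X \<longleftrightarrow>
     f \<in> extensional X \<and> continuous_map (subtopology Qtop X) euclidean f \<and>
     (\<forall>e>0. \<exists>p\<in>I0. \<forall>u\<in>X. cmod (f u - u p) \<le> e)"
proof -
  have XQ: "X \<subseteq> Qset"
    using compactin_subset_topspace[OF X] by (simp add: topspace_Qtop)
  then have top: "topspace (subtopology Qtop X) = X"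
    by (auto simp: topspace_Qtop)
  then have Xt: "topspace Qtop \<inter> X = X" by simp
  have sp: "f \<in> mspace C \<longleftrightarrow> f \<in> extensional X \<and> continuous_map (subtopology Qtop X) euclidean f" for f
    unfolding C_def
    using compactin_mspace_cfunspace[of "subtopology Qtop X" euclidean_metric] X
    by (simp add: Xt compactin_subtopology mtopology_of_euclidean set_eq_iff) blast
  have R: "restrict_I0 X \<subseteq> mspace C"
  proof
    fix g assume "g \<in> restrict_I0 X"
    then obtain p where p: "p \<in> I0" "g = (\<lambda>u\<in>X. u p)"
      by (auto simp: restrict_I0_def)
    have "continuous_map (subtopology Qtop X) euclidean (\<lambda>u. u p)"
      by (intro continuous_map_from_subtopology continuous_map_eval p)
    then have "continuous_map (subtopology Qtop X) euclidean g"
      by (rule continuous_map_eq) (simp add: p(2) top del: topspace_subtopology)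
    then show "g \<in> mspace C"
      by (simp add: sp p(2))
  qed
  interpret M: Metric_space "mspace C" "mdist C"
    by (rule Metric_space_mspace_mdist)
  have dist: "mdist C f g \<le> e \<longleftrightarrow> (\<forall>u\<in>X. cmod (f u - g u) \<le> e)"
    if "f \<in> mspace C" "g \<in> mspace C" "e > 0" for f g e
  proof
    assume "mdist C f g \<le> e"
    then show "\<forall>u\<in>X. cmod (f u - g u) \<le> e"
      using mdist_cfunspace_imp_mdist_le[of f "subtopology Qtop X" euclidean_metric g e] that
      by (auto simp: C_def Xt dist_norm)
  next
    assume "\<forall>u\<in>X. cmod (f u - g u) \<le> e"
    then show "mdist C f g \<le> e"
      unfolding C_def using that(3) top
      by (intro mdist_cfunspace_le) (auto simp: dist_norm)
  qed
  have img: "restrict_I0 X = (\<lambda>p. \<lambda>u\<in>X. u p) ` I0"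
    unfolding restrict_I0_def by (rule Setcompr_eq_image)
  have "f \<in> mtopology_of C closure_of restrict_I0 X \<longleftrightarrow>
      f \<in> mspace C \<and> (\<forall>e>0. \<exists>g\<in>restrict_I0 X. g \<in> M.mcball f e)"
    unfolding mtopology_of_def M.metric_closure_of_alt by simp
  also have "\<dots> \<longleftrightarrow> f \<in> mspace C \<and> (\<forall>e>0. \<exists>g\<in>restrict_I0 X. \<forall>u\<in>X. cmod (f u - g u) \<le> e)"
    using R dist[of f] by (intro conj_cong refl all_cong bex_cong) (simp add: subset_iff)
  also have "\<dots> \<longleftrightarrow> f \<in> mspace C \<and> (\<forall>e>0. \<exists>p\<in>I0. \<forall>u\<in>X. cmod (f u - u p) \<le> e)"
    by (simp add: img)
  finally show ?thesis
    by (simp add: sp conj_assoc)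
qed

lemma eval_mem_closure_restrict_I0:
  fixes X :: "('d::finite, 'n::finite) qpoint set"
  assumes "compactin Qtop X" "p \<in> I0"
  shows "(\<lambda>u\<in>X. u p) \<in> mtopology_of (cfunspace (subtopology Qtop X) euclidean_metric)
           closure_of restrict_I0 X"
proof -
  have "continuous_map (subtopology Qtop X) euclidean (\<lambda>u. u p)"
    by (intro continuous_map_from_subtopology continuous_map_eval assms(2))
  then have "continuous_map (subtopology Qtop X) euclidean (\<lambda>u\<in>X. u p)"
    by (rule continuous_map_eq) simp
  moreover have "\<forall>e>0. \<exists>q\<in>I0. \<forall>u\<in>X. cmod ((\<lambda>u\<in>X. u p) u - u q) \<le> e"
    using assms(2) by (intro allI impI bexI[of _ p]) auto
  ultimately show ?thesis
    unfolding mem_closure_restrict_I0[OF assms(1)] by simp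
qed

lemma function_alg_closure_restrict_I0:
  fixes X :: "('d::finite, 'n::finite) qpoint set"
  assumes X: "compactin Qtop X" "X \<noteq> {}"
  shows "function_alg (subtopology Qtop X)
    (mtopology_of (cfunspace (subtopology Qtop X) euclidean_metric) closure_of restrict_I0 X)"
    (is "function_alg ?X ?A")
proof
  have XQ: "X \<subseteq> Qset"
    using compactin_subset_topspace[OF X(1)] by (simp add: topspace_Qtop)
  have top: "topspace ?X = X"
    using XQ by (auto simp: topspace_Qtop)
  note mem = mem_closure_restrict_I0[OF X(1)]
  show cs: "compact_space ?X"
    using X(1) by (rule compact_space_subtopology)
  show "topspace ?X \<noteq> {}"
    using X(2) top by metis
  show cont: "continuous_map ?X euclidean f" if "f \<in> ?A" for f
    using that unfolding mem by blast
  show "(\<lambda>x\<in>topspace ?X. c) \<in> ?A" for c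
  proof -
    have "(\<lambda>u\<in>X. u (\<lambda>z. c)) = (\<lambda>u\<in>X. c)"
      using XQ by (intro restrict_ext) (simp add: Qset_const subset_iff)
    then show ?thesis
      using eval_mem_closure_restrict_I0[OF X(1) I0_const, of c] unfolding top by simp
  qed
  have bdd: "\<exists>M>0. \<forall>u\<in>X. cmod (f u) \<le> M" if f: "f \<in> ?A" for f
  proof -
    have "compactin ?X X"
      using cs unfolding compact_space_def top .
    then obtain x where "x \<in> X" "\<And>y. y \<in> X \<Longrightarrow> cmod (f y) \<le> cmod (f x)"
      using compactin_attains_max_cmod[OF _ X(2) cont[OF f]] by blast
    then show ?thesis
      by (intro exI[of _ "cmod (f x) + 1"]) (auto intro: add_nonneg_pos add_increasing2)
  qed
  show "(\<lambda>x\<in>topspace ?X. f x * g x) \<in> ?A" if f: "f \<in> ?A" and g: "g \<in> ?A" for f g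
    unfolding mem top
  proof (intro conjI allI impI)
    have "continuous_map ?X euclidean (\<lambda>x. f x * g x)"
      using cont[OF f] cont[OF g] by (simp add: continuous_map_atin tendsto_mult)
    then show "continuous_map ?X euclidean (\<lambda>x\<in>X. f x * g x)"
      by (rule continuous_map_eq) simp
    fix e :: real assume e: "e > 0"
    obtain M where M: "M > 0" "\<And>u. u \<in> X \<Longrightarrow> cmod (f u) \<le> M"
      using bdd[OF f] by blast
    obtain N where N: "N > 0" "\<And>u. u \<in> X \<Longrightarrow> cmod (g u) \<le> N"
      using bdd[OF g] by blast
    define r where "r = min 1 (e / (M + N + 1))"
    have r: "r > 0" "r \<le> 1" "r * (M + N + 1) \<le> e"
    proof -
      have pos: "M + N + 1 > 0" using M(1) N(1) by linarith
      show "r > 0" "r \<le> 1" using e pos by (simp_all add: r_def)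
      have "r * (M + N + 1) \<le> e / (M + N + 1) * (M + N + 1)"
        using pos by (intro mult_right_mono) (auto simp: r_def)
      then show "r * (M + N + 1) \<le> e" using pos by simp
    qed
    obtain p where p: "p \<in> I0" "\<And>u. u \<in> X \<Longrightarrow> cmod (f u - u p) \<le> r"
      using f r(1) unfolding mem by blast
    obtain q where q: "q \<in> I0" "\<And>u. u \<in> X \<Longrightarrow> cmod (g u - u q) \<le> r"
      using g r(1) unfolding mem by blast
    show "\<exists>h\<in>I0. \<forall>u\<in>X. cmod ((\<lambda>x\<in>X. f x * g x) u - u h) \<le> e"
    proof (intro bexI ballI)
      show "(\<lambda>z. p z * q z) \<in> I0"
        by (rule I0_mult[OF p(1) q(1)])
      fix u assume u: "u \<in> X"
      have uh: "u (\<lambda>z. p z * q z) = u p * u q"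
        using u XQ by (intro Qset_mult p(1) q(1)) auto
      \<comment> \<open>The second factor is \<open>u q\<close>, in the form in which it is bounded by \<open>N + 1\<close>.\<close>
      have eq: "f u * g u - u p * u q = f u * (g u - u q) + (f u - u p) * (g u - (g u - u q))"
        by (simp add: algebra_simps)
      have "cmod (f u * g u - u p * u q) \<le> cmod (f u) * cmod (g u - u q) + cmod (f u - u p) * (cmod (g u) + cmod (g u - u q))"
        unfolding eq
        by (rule order_trans[OF norm_triangle_ineq], unfold norm_mult)
           (intro add_mono mult_left_mono order_refl norm_triangle_ineq4 norm_ge_zero)
      also have "\<dots> \<le> M * r + r * (N + 1)"
        using M(2)[OF u] N(2)[OF u] p(2)[OF u] q(2)[OF u] r M(1) N(1)
        by (intro add_mono mult_mono) auto
      also have "\<dots> \<le> e"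
        using r(3) by (simp add: algebra_simps)
      finally show "cmod ((\<lambda>x\<in>X. f x * g x) u - u (\<lambda>z. p z * q z)) \<le> e"
        using u by (simp add: uh)
    qed
  qed simp
  show "\<exists>F. finite F \<and> F \<subseteq> ?A \<and> (\<forall>f\<in>F. f x = 0) \<and>
          (\<forall>y\<in>topspace ?X. (\<forall>f\<in>F. cmod (f y) < 1) \<longrightarrow> y \<in> U)"
    if opU: "openin ?X U" and x: "x \<in> U" for U x
  proof -
    obtain T where T: "openin Qtop T" "U = T \<inter> X"
      using opU unfolding openin_subtopology by blast
    obtain J e where J: "finite J" "J \<subseteq> I0" "e > 0"
      "\<forall>v\<in>Qset. (\<forall>p\<in>J. cmod (v p - x p) < e) \<longrightarrow> v \<in> T"
    proof (rule Qtop_weak_nbhd[OF T(1)])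
      show "x \<in> T" using x T(2) by blast
    qed (rule that)
    \<comment> \<open>Translation and scaling turn \<open>\<bar>v p - x p\<bar> < e\<close> into \<open>\<bar>v (h p)\<bar> < 1\<close> with \<open>x (h p) = 0\<close>.\<close>
    define h where "h p = (\<lambda>z. (p z - x p) * (1 / of_real e))" for p :: "('d, 'n) mtuple \<Rightarrow> complex"
    have hI: "h p \<in> I0" if "p \<in> J" for p
      unfolding h_def using that J(2) by (intro I0_mult I0_diff I0_const) auto
    have hv: "v (h p) = (v p - x p) / of_real e" if "p \<in> J" "v \<in> X" for p v
    proof -
      have v: "v \<in> Qset" and p: "p \<in> I0" using that XQ J(2) by auto
      show ?thesis
        unfolding h_def
        by (simp only: Qset_mult[OF v I0_diff[OF p I0_const] I0_const]
            Qset_diff[OF v p I0_const] Qset_const[OF v]) simp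
    qed
    show ?thesis
    proof (intro exI[of _ "(\<lambda>p. \<lambda>u\<in>X. u (h p)) ` J"] conjI ballI impI)
      show "(\<lambda>p. \<lambda>u\<in>X. u (h p)) ` J \<subseteq> ?A"
        using eval_mem_closure_restrict_I0[OF X(1) hI] by blast
      show "f x = 0" if f: "f \<in> (\<lambda>p. \<lambda>u\<in>X. u (h p)) ` J" for f
      proof -
        obtain p where p: "p \<in> J" "f = (\<lambda>u\<in>X. u (h p))"
          using f by blast
        have "x \<in> X" using x T(2) by blast
        then show ?thesis
          using hv[OF p(1), of x] by (simp add: p(2))
      qed
      fix y assume y: "y \<in> topspace ?X" "\<forall>f\<in>(\<lambda>p. \<lambda>u\<in>X. u (h p)) ` J. cmod (f y) < 1"
      then have yX: "y \<in> X" by simp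
      have "cmod (y p - x p) < e" if "p \<in> J" for p
      proof -
        have "cmod ((\<lambda>u\<in>X. u (h p)) y) < 1"
          using y(2) that by blast
        then show ?thesis
          using yX hv[OF that yX] J(3) by (simp add: norm_divide)
      qed
      then show "y \<in> U"
        using bspec[OF J(4), of y] yX XQ T(2) by blast
    qed (use J(1) in simp)
  qed
qed

text \<open>Since the maximum modulus over \<open>X\<close> is already attained on a closed boundary \<open>B\<close>,
  sequences of regular functions that converge uniformly on \<open>B\<close> converge uniformly on \<open>X\<close>.\<close>

lemma extend_uniform_limit_from_boundary:
  fixes X :: "('d::finite, 'n::finite) qpoint set"
  assumes X: "compactin Qtop X"
  defines "A \<equiv> mtopology_of (cfunspace (subtopology Qtop X) euclidean_metric) closure_of restrict_I0 X"
  assumes B: "closed_boundary (subtopology Qtop X) A B"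
    and c: "\<And>e. e > 0 \<Longrightarrow> \<exists>p\<in>I0. \<forall>u\<in>B. cmod (c u - u p) \<le> e"
  obtains f where "f \<in> A" "\<And>u. u \<in> B \<Longrightarrow> f u = c u"
proof -
  have XQ: "X \<subseteq> Qset"
    using compactin_subset_topspace[OF X] by (simp add: topspace_Qtop)
  have top: "topspace (subtopology Qtop X) = X"
    using XQ by (auto simp: topspace_Qtop)
  have BX: "B \<subseteq> X"
    using B closedin_subset[of "subtopology Qtop X" B] unfolding closed_boundary_def top by blast
  have max: "cmod (u p) \<le> e" if "p \<in> I0" "u \<in> X" "\<And>v. v \<in> B \<Longrightarrow> cmod (v p) \<le> e" for p u e
  proof -
    have "(\<lambda>u\<in>X. u p) \<in> A"
      unfolding A_def by (rule eval_mem_closure_restrict_I0[OF X that(1)])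
    then obtain v where "v \<in> B" "\<forall>y\<in>X. cmod ((\<lambda>u\<in>X. u p) y) \<le> cmod ((\<lambda>u\<in>X. u p) v)"
      using B unfolding closed_boundary_def top by meson
    then show ?thesis
      using that BX by force
  qed
  have "\<forall>n. \<exists>p\<in>I0. \<forall>u\<in>B. cmod (c u - u p) \<le> inverse (real (Suc n))"
    by (intro allI c) simp
  then obtain p where p: "\<And>n. p n \<in> I0" "\<And>n u. u \<in> B \<Longrightarrow> cmod (c u - u (p n)) \<le> inverse (real (Suc n))"
    by metis
  have pp: "cmod (u (p m) - u (p n)) \<le> inverse (real (Suc m)) + inverse (real (Suc n))"
    if "u \<in> X" for u m n
  proof -
    have "cmod (v (\<lambda>z. p m z - p n z)) \<le> inverse (real (Suc m)) + inverse (real (Suc n))"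
      if "v \<in> B" for v
    proof -
      have "v (\<lambda>z. p m z - p n z) = (c v - v (p n)) - (c v - v (p m))"
        using that BX XQ by (subst Qset_diff) (auto simp: p)
      then show ?thesis
        using norm_triangle_ineq4[of "c v - v (p n)" "c v - v (p m)"] p(2)[OF that, of m] p(2)[OF that, of n]
        by simp
    qed
    then have "cmod (u (\<lambda>z. p m z - p n z)) \<le> inverse (real (Suc m)) + inverse (real (Suc n))"
      by (rule max[OF I0_diff[OF p(1) p(1)] that])
    then show ?thesis
      using that XQ by (subst (asm) Qset_diff) (auto simp: p)
  qed
  have lim0: "(\<lambda>n. inverse (real (Suc n))) \<longlonglongrightarrow> 0"
    by (rule LIMSEQ_inverse_real_of_nat)
  have "\<exists>l. (\<lambda>n. u (p n)) \<longlonglongrightarrow> l" if u: "u \<in> X" for u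
  proof -
    have "Cauchy (\<lambda>n. u (p n))"
    proof (rule metric_CauchyI)
      fix e :: real assume "e > 0"
      then obtain N where N: "\<And>n. n \<ge> N \<Longrightarrow> inverse (real (Suc n)) < e / 2"
        using order_tendstoD(2)[OF lim0, of "e / 2"] by (auto simp: eventually_sequentially)
      show "\<exists>M. \<forall>m\<ge>M. \<forall>n\<ge>M. dist (u (p m)) (u (p n)) < e"
      proof (intro exI[of _ N] allI impI)
        fix m n assume "N \<le> m" "N \<le> n"
        then show "dist (u (p m)) (u (p n)) < e"
          using N[of m] N[of n] pp[OF u, of m n] unfolding dist_norm by linarith
      qed
    qed
    then show ?thesis
      by (simp add: Cauchy_convergent_iff convergent_def)
  qed
  then obtain l where l: "\<And>u. u \<in> X \<Longrightarrow> (\<lambda>n. u (p n)) \<longlonglongrightarrow> l u"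
    by metis
  have lp: "cmod (l u - u (p n)) \<le> inverse (real (Suc n))" if "u \<in> X" for u n
  proof (rule tendsto_le[OF sequentially_bot])
    show "(\<lambda>m. cmod (u (p m) - u (p n))) \<longlonglongrightarrow> cmod (l u - u (p n))"
      by (intro tendsto_intros l that)
    show "(\<lambda>m. inverse (real (Suc m)) + inverse (real (Suc n))) \<longlonglongrightarrow> inverse (real (Suc n))"
      using tendsto_add[OF lim0 tendsto_const, of "inverse (real (Suc n))"] by simp
  qed (rule always_eventually, rule allI, rule pp[OF that])
  show thesis
  proof (rule that)
    show "(\<lambda>u\<in>X. l u) \<in> A"
      unfolding A_def mem_closure_restrict_I0[OF X]
    proof (intro conjI allI impI)
      have "continuous_map (subtopology Qtop X) Met_TC.mtopology l"
      proof (rule Met_TC.continuous_map_uniform_limit[OF _ _ sequentially_bot])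
        show "\<forall>\<^sub>F n in sequentially. continuous_map (subtopology Qtop X) Met_TC.mtopology (\<lambda>u. u (p n))"
          by (intro always_eventually allI)
             (simp add: continuous_map_from_subtopology continuous_map_eval p)
        fix e :: real assume e: "e > 0"
        show "\<forall>\<^sub>F n in sequentially. \<forall>u\<in>topspace (subtopology Qtop X). l u \<in> UNIV \<and> dist (u (p n)) (l u) < e"
          using order_tendstoD(2)[OF lim0 e]
        proof eventually_elim
          case (elim n)
          show ?case
          proof (intro ballI conjI UNIV_I)
            fix u assume "u \<in> topspace (subtopology Qtop X)"
            then have "cmod (l u - u (p n)) < e"
              using lp[of u n] elim by simp
            then show "dist (u (p n)) (l u) < e"
              by (simp add: dist_norm norm_minus_commute)
          qed
        qed
      qed
      then have "continuous_map (subtopology Qtop X) euclidean l" by simp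
      then show "continuous_map (subtopology Qtop X) euclidean (\<lambda>u\<in>X. l u)"
        by (rule continuous_map_eq) simp
      fix e :: real assume "e > 0"
      then obtain n where "inverse (real (Suc n)) < e"
        using reals_Archimedean by blast
      then show "\<exists>p\<in>I0. \<forall>u\<in>X. cmod ((\<lambda>u\<in>X. l u) u - u p) \<le> e"
        using order_trans[OF lp less_imp_le] by (intro bexI[OF _ p(1)[of n]]) simp
    qed simp
    fix u assume u: "u \<in> B"
    have "(\<lambda>n. u (p n)) \<longlonglongrightarrow> c u"
    proof (rule LIM_zero_cancel, rule Lim_null_comparison[OF _ lim0])
      show "\<forall>\<^sub>F n in sequentially. norm (u (p n) - c u) \<le> inverse (real (Suc n))"
      proof (intro always_eventually allI)
        show "norm (u (p n) - c u) \<le> inverse (real (Suc n))" for n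
          using p(2)[OF u, of n] unfolding norm_minus_commute[of "c u"] .
      qed
    qed
    moreover have "u \<in> X"
      using u BX by blast
    ultimately show "(\<lambda>u\<in>X. l u) u = c u"
      using LIMSEQ_unique[OF l] by simp
  qed
qed

section \<open>The associated matrix bundle\<close>

lemma quotient_map_quotient_topology: "quotient_map X (quotient_topology X q) q"
proof -
  let ?P = "\<lambda>U. U \<subseteq> q ` topspace X \<and> openin X {x \<in> topspace X. q x \<in> U}"
  have "istopology ?P"
    unfolding istopology_def
  proof (intro conjI allI impI)
    fix S T assume S: "?P S" and T: "?P T"
    have "{x \<in> topspace X. q x \<in> S \<inter> T} = {x \<in> topspace X. q x \<in> S} \<inter> {x \<in> topspace X. q x \<in> T}"
      by blast
    then show "openin X {x \<in> topspace X. q x \<in> S \<inter> T}"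
      using S T by (simp add: openin_Int)
    show "S \<inter> T \<subseteq> q ` topspace X"
      using S by blast
  next
    fix \<K> assume K: "\<forall>K\<in>\<K>. ?P K"
    have "{x \<in> topspace X. q x \<in> \<Union>\<K>} = (\<Union>K\<in>\<K>. {x \<in> topspace X. q x \<in> K})"
      by blast
    moreover have "openin X (\<Union>K\<in>\<K>. {x \<in> topspace X. q x \<in> K})"
      using K by (intro openin_Union) auto
    ultimately show "openin X {x \<in> topspace X. q x \<in> \<Union>\<K>}"
      by (simp only:)
    show "\<Union>\<K> \<subseteq> q ` topspace X"
      using K by blast
  qed
  then have op: "openin (quotient_topology X q) U \<longleftrightarrow> ?P U" for U
    by (simp add: quotient_topology_def topology_inverse')
  have "?P (q ` topspace X)"
  proof
    have "{x \<in> topspace X. q x \<in> q ` topspace X} = topspace X" by blast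
    then show "openin X {x \<in> topspace X. q x \<in> q ` topspace X}" by simp
  qed simp
  then have top: "topspace (quotient_topology X q) = q ` topspace X"
    using op openin_subset[of "quotient_topology X q"] openin_topspace[of "quotient_topology X q"]
    by (intro subset_antisym) blast+
  show ?thesis
    unfolding quotient_map_def top using op by blast
qed

lemma bclass_eq_iff:
  fixes z w :: "('d::finite, 'n::finite) mtuple"
  shows "bclass z A = bclass w B \<longleftrightarrow> (\<exists>k\<in>unitary_group. w = conj_tuple k z \<and> B = conj_mat k A)"
proof
  assume "bclass z A = bclass w B"
  moreover have "(w, B) \<in> bclass w B"
    unfolding bclass_def using unitary_one conj_tuple_id conj_mat_id by (metis (mono_tags, lifting) mem_Collect_eq)
  ultimately have "(w, B) \<in> bclass z A" by simp
  then show "\<exists>k\<in>unitary_group. w = conj_tuple k z \<and> B = conj_mat k A"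
    unfolding bclass_def by blast
next
  assume "\<exists>k\<in>unitary_group. w = conj_tuple k z \<and> B = conj_mat k A"
  then obtain k where k: "k \<in> unitary_group" and w: "w = conj_tuple k z" and B: "B = conj_mat k A"
    by blast
  have k': "cadjoint k \<in> unitary_group" "k ** cadjoint k = mat 1"
    using k unitary_cadjoint by (auto simp: unitary_group_def)
  have sub: "bclass (conj_tuple l z) (conj_mat l A) \<subseteq> bclass z A"
    if l: "l \<in> unitary_group" for l ::  "'n cmat" and z :: "('d, 'n) mtuple" and A
    unfolding bclass_def
    using l by (auto simp: conj_tuple_conj_tuple conj_mat_conj_mat unitary_invertible intro: unitary_mult)
  have "z = conj_tuple (cadjoint k) w" "A = conj_mat (cadjoint k) B"
    unfolding w B using k k'
    by (simp_all add: conj_tuple_conj_tuple conj_mat_conj_mat unitary_invertible conj_tuple_id conj_mat_id)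
  then show "bclass z A = bclass w B"
    using sub[OF k, of z A] sub[OF k'(1), of w B] w B by auto
qed

text \<open>A unitary-invariant function of \<open>(z, A)\<close> is a function of the class of \<open>(z, A)\<close>.\<close>

lemma the_bclass_invariant:
  assumes "\<And>k. k \<in> unitary_group \<Longrightarrow> F (conj_tuple k z) (conj_mat k A) = F z A"
  shows "(THE r. \<exists>z' A'. bclass z A = bclass z' A' \<and> r = F z' A') = F z A"
proof (rule the_equality)
  show "\<exists>z' A'. bclass z A = bclass z' A' \<and> F z A = F z' A'"
    by blast
  show "r = F z A" if "\<exists>z' A'. bclass z A = bclass z' A' \<and> r = F z' A'" for r
    using that assms by (auto simp: bclass_eq_iff)
qed

lemma bproj_bclass: "bproj (bclass z A) = pi0 z"
  unfolding bproj_def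
  by (rule the_bclass_invariant[where F = "\<lambda>z A. pi0 z"]) (simp add: pi0_conj unitary_invertible)

lemma fibre_norm_bclass: "fibre_norm (bclass z A) = onorm (\<lambda>x. A *v x)"
  unfolding fibre_norm_def
  by (rule the_bclass_invariant[where F = "\<lambda>z A. onorm (\<lambda>x. A *v x)"]) (rule onorm_conj_unitary)

lemma tau_bclass:
  fixes A :: "'n::finite cmat"
  shows "tau (bclass z A) = trace A / of_nat CARD('n)"
  unfolding tau_def
  by (rule the_bclass_invariant[where F = "\<lambda>z A. trace A / of_nat CARD('n)"])
     (simp add: trace_conj_mat unitary_invertible)

lemma Vset_stabilizer:
  assumes "z \<in> Vset" "invertible k" "conj_tuple k z = z"
  shows "conj_mat k A = A"
proof -
  have "conj_mat k (z $ i) = z $ i" for i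
    using assms(3) by (metis conj_tuple_nth)
  then have "k ** z $ i = z $ i ** k" for i
    using conj_mat_eq_self_iff[OF assms(2)] by blast
  then have "k ** A = A ** k"
    by (rule Vset_commutant[OF assms(1)])
  then show ?thesis
    using conj_mat_eq_self_iff[OF assms(2)] by blast
qed

text \<open>Over a generating tuple, a class determines its matrix, because only scalars
  stabilize the tuple.\<close>

lemma bclass_inject:
  assumes "z \<in> Vset"
  shows "bclass z A = bclass z B \<longleftrightarrow> A = B"
  using Vset_stabilizer[OF assms unitary_invertible] by (metis bclass_eq_iff)

text \<open>Two representatives with the same first component come from unitaries that differ by a
  stabilizer, which acts trivially on matrices.\<close>

lemma fibre_op_bclass:
  assumes z: "z \<in> Vset"
    and h: "\<And>k A B. k \<in> unitary_group \<Longrightarrow> h (conj_mat k A) (conj_mat k B) = conj_mat k (h A B)"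
  shows "fibre_op h (bclass z A) (bclass z B) = bclass z (h A B)"
proof (intro subset_antisym subsetI)
  fix e assume "e \<in> fibre_op h (bclass z A) (bclass z B)"
  then obtain k l where k: "k \<in> unitary_group" and l: "l \<in> unitary_group"
    and eq: "conj_tuple k z = conj_tuple l z"
    and e: "e = (conj_tuple k z, h (conj_mat k A) (conj_mat l B))"
    unfolding fibre_op_def bclass_def by auto
  have l': "cadjoint l \<in> unitary_group" "l ** cadjoint l = mat 1" "cadjoint l ** l = mat 1"
    using l unitary_cadjoint by (auto simp: unitary_group_def)
  have "conj_tuple (k ** cadjoint l) z = conj_tuple (cadjoint l) (conj_tuple l z)"
    using k l'(1) by (simp add: conj_tuple_conj_tuple[symmetric] unitary_invertible eq)
  also have "\<dots> = z"
    using l l' by (simp add: conj_tuple_conj_tuple unitary_invertible conj_tuple_id)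
  finally have "conj_mat (k ** cadjoint l) B = B"
    by (rule Vset_stabilizer[OF z unitary_invertible[OF unitary_mult[OF k l'(1)]]])
  then have "conj_mat l B = conj_mat l (conj_mat (k ** cadjoint l) B)"
    by simp
  also have "\<dots> = conj_mat k B"
    using k l l' by (simp add: conj_mat_conj_mat unitary_invertible unitary_mult matrix_mul_assoc[symmetric])
  finally show "e \<in> bclass z (h A B)"
    using k by (auto simp: e h bclass_def)
next
  fix e assume "e \<in> bclass z (h A B)"
  then show "e \<in> fibre_op h (bclass z A) (bclass z B)"
    unfolding fibre_op_def bclass_def by (force simp: h[symmetric])
qed

lemma fibre_op_mult_bclass:
  "z \<in> Vset \<Longrightarrow> fibre_op (**) (bclass z A) (bclass z B) = bclass z (A ** B)"
  by (rule fibre_op_bclass) (simp_all add: conj_mat_mult unitary_invertible)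

lemma fibre_op_diff_bclass:
  "z \<in> Vset \<Longrightarrow> fibre_op (-) (bclass z A) (bclass z B) = bclass z (A - B)"
  by (rule fibre_op_bclass) (simp_all add: conj_mat_diff)

lemma quotient_map_total_space:
  "quotient_map (top_of_set (P \<times> UNIV)) (total_space P) (\<lambda>(z, A). bclass z A)"
  unfolding total_space_def by (rule quotient_map_quotient_topology)

lemma topspace_total_space: "topspace (total_space P) = (\<lambda>(z, A). bclass z A) ` (P \<times> UNIV)"
  using quotient_imp_surjective_map[OF quotient_map_total_space, of P] by simp

text \<open>The operator norm is continuous on matrices and unitarily invariant, so it descends to the
  quotient.\<close>

lemma continuous_map_fibre_norm:
  fixes P :: "('d::finite, 'n::finite) mtuple set"
  shows "continuous_map (total_space P) euclidean fibre_norm"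
proof (rule continuous_compose_quotient_map[OF quotient_map_total_space])
  have "continuous_on (P \<times> UNIV) (\<lambda>x :: ('d, 'n) mtuple \<times> 'n cmat. onorm (\<lambda>v. snd x *v v))"
    by (rule continuous_on_compose2[OF continuous_on_onorm_matrix continuous_on_snd[OF continuous_on_id]])
       simp
  then show "continuous_map (top_of_set (P \<times> UNIV)) euclidean (fibre_norm \<circ> (\<lambda>(z, A). bclass z A))"
    by (simp add: o_def case_prod_beta fibre_norm_bclass)
qed

section \<open>Continuous sections over a compact set\<close>

text \<open>A reduction over a compact set \<open>X\<close> of the quotient, and a closed subset \<open>B\<close> of \<open>X\<close> over which
  sections are considered.\<close>

locale reduction =
  fixes X :: "('d::finite, 'n::finite) qpoint set" and P :: "('d, 'n) mtuple set"
    and B :: "('d, 'n) qpoint set"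
  assumes reduction: "is_reduction X P"
    and X: "compactin Qtop X"
    and B: "closedin (subtopology Qtop X) B"
begin

lemma P_Vset: "z \<in> P \<Longrightarrow> z \<in> Vset"
  using reduction unfolding is_reduction_def by blast

lemma X_Qset: "X \<subseteq> Qset"
  using compactin_subset_topspace[OF X] by (simp add: topspace_Qtop)

lemma B_X: "B \<subseteq> X"
  using closedin_subset[OF B] by simp

lemma pi0_surj:
  assumes "u \<in> X"
  obtains z where "z \<in> P" "pi0 z = u"
proof -
  have "pi0 ` P = topspace (subtopology Qtop X)"
    using reduction quotient_imp_surjective_map unfolding is_reduction_def by fastforce
  also have "\<dots> = X"
    using X_Qset by (simp add: topspace_Qtop Int_absorb1)
  finally obtain z where "z \<in> P" "u = pi0 z"
    using assms by (metis imageE)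
  then show ?thesis
    using that by simp
qed

lemma same_orbit:
  assumes "z \<in> P" "w \<in> P" "pi0 z = pi0 w"
  obtains k where "k \<in> unitary_group" "w = conj_tuple k z"
  using reduction assms unfolding is_reduction_def by blast

lemma equivariant_section_apply:
  assumes "\<And>k z. k \<in> unitary_group \<Longrightarrow> z \<in> P \<Longrightarrow> \<phi> (conj_tuple k z) = conj_mat k (\<phi> z)"
    and "z \<in> P" "pi0 z \<in> B"
  shows "equivariant_section B P \<phi> (pi0 z) = bclass z (\<phi> z)"
proof -
  have "(THE e. \<exists>w\<in>P. pi0 w = pi0 z \<and> e = bclass w (\<phi> w)) = bclass z (\<phi> z)"
  proof (rule the_equality)
    show "\<exists>w\<in>P. pi0 w = pi0 z \<and> bclass z (\<phi> z) = bclass w (\<phi> w)"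
      using assms(2) by blast
    fix e assume "\<exists>w\<in>P. pi0 w = pi0 z \<and> e = bclass w (\<phi> w)"
    then obtain w where w: "w \<in> P" "pi0 z = pi0 w" "e = bclass w (\<phi> w)"
      by metis
    obtain k where k: "k \<in> unitary_group" "w = conj_tuple k z"
      using same_orbit[OF assms(2) w(1,2)] .
    show "e = bclass z (\<phi> z)"
      unfolding w(3) using k assms(1)[OF k(1) assms(2)] by (subst eq_commute) (auto simp: bclass_eq_iff)
  qed
  then show ?thesis
    using assms(3) by (simp add: equivariant_section_def)
qed

text \<open>The quotient map onto \<open>X\<close> restricts to a quotient map over the closed set \<open>B\<close>, so continuity
  of a section may be tested on the part of \<open>P\<close> over \<open>B\<close>.\<close>

lemma equivariant_section_Gamma_c:
  assumes eq: "\<And>k z. k \<in> unitary_group \<Longrightarrow> z \<in> P \<Longrightarrow> \<phi> (conj_tuple k z) = conj_mat k (\<phi> z)"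
    and cont: "continuous_on {z \<in> P. pi0 z \<in> B} \<phi>"
  shows "equivariant_section B P \<phi> \<in> Gamma_c B P"
proof -
  let ?P = "{z \<in> P. pi0 z \<in> B}" and ?s = "equivariant_section B P \<phi>"
  have "quotient_map (subtopology (top_of_set P) ?P) (subtopology (subtopology Qtop X) B) pi0"
    using reduction B unfolding is_reduction_def
    by (intro quotient_map_restriction[of "top_of_set P" "subtopology Qtop X"]) auto
  moreover have "subtopology (top_of_set P) ?P = top_of_set ?P"
    by (simp add: subtopology_subtopology Int_def conj_ac)
  moreover have "subtopology (subtopology Qtop X) B = subtopology Qtop B"
    using B_X by (simp add: subtopology_subtopology Int_absorb1)
  ultimately have q: "quotient_map (top_of_set ?P) (subtopology Qtop B) pi0"
    by simp
  have "continuous_map (top_of_set ?P) (top_of_set (P \<times> UNIV)) (\<lambda>z. (z, \<phi> z))"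
    using cont by (auto simp: continuous_map_in_subtopology intro!: continuous_intros)
  then have "continuous_map (top_of_set ?P) (total_space P) ((\<lambda>(z, A). bclass z A) \<circ> (\<lambda>z. (z, \<phi> z)))"
    by (rule continuous_map_compose) (rule quotient_imp_continuous_map[OF quotient_map_total_space])
  then have "continuous_map (top_of_set ?P) (total_space P) (?s \<circ> pi0)"
    by (rule continuous_map_eq) (simp add: equivariant_section_apply[OF eq])
  then have "continuous_map (subtopology Qtop B) (total_space P) ?s"
    by (rule continuous_compose_quotient_map[OF q])
  moreover have "bproj (?s u) = u" if u: "u \<in> B" for u
  proof -
    obtain z where "z \<in> P" "pi0 z = u"
      using pi0_surj u B_X by blast
    then show ?thesis
      using equivariant_section_apply[OF eq] u bproj_bclass by metis
  qed
  ultimately show ?thesis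
    by (simp add: Gamma_c_def equivariant_section_def)
qed

lemma Gamma_c_value:
  assumes "\<sigma> \<in> Gamma_c B P" "u \<in> B"
  obtains z A where "z \<in> P" "pi0 z = u" "\<sigma> u = bclass z A"
proof -
  have "u \<in> topspace (subtopology Qtop B)"
    using assms(2) B_X X_Qset by (auto simp: topspace_Qtop)
  then have "\<sigma> u \<in> topspace (total_space P)"
    using assms(1) continuous_map_image_subset_topspace unfolding Gamma_c_def by blast
  then obtain z A where "z \<in> P" "\<sigma> u = bclass z A"
    by (auto simp: topspace_total_space)
  moreover from this have "pi0 z = u"
    using assms bproj_bclass[of z A] unfolding Gamma_c_def by auto
  ultimately show ?thesis
    using that by blast
qed

lemma Gamma_c_bounded:
  assumes "\<sigma> \<in> Gamma_c B P"
  obtains M where "\<And>u. u \<in> B \<Longrightarrow> fibre_norm (\<sigma> u) \<le> M"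
proof -
  have "compactin (subtopology Qtop X) B"
    using B compact_space_subtopology[OF X] closedin_compact_space by blast
  then have "compactin (subtopology Qtop B) B"
    by (simp add: compactin_subtopology)
  moreover have "continuous_map (subtopology Qtop B) euclidean (fibre_norm \<circ> \<sigma>)"
    using assms continuous_map_fibre_norm unfolding Gamma_c_def by (auto intro: continuous_map_compose)
  ultimately have "compactin euclidean ((fibre_norm \<circ> \<sigma>) ` B)"
    by (rule image_compactin)
  then have "bdd_above ((fibre_norm \<circ> \<sigma>) ` B)"
    by (simp add: bounded_imp_bdd_above compact_imp_bounded)
  then show thesis
    using that by (auto simp: bdd_above_def)
qed

text \<open>The bound of the norms makes the supremum in the definition of the norm a true supremum.\<close>

lemma fibre_norm_le_sec_norm_diff:
  assumes "\<sigma> \<in> Gamma_c B P" "\<rho> \<in> Gamma_c B P" and z: "z \<in> P" "pi0 z \<in> B"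
    and "\<sigma> (pi0 z) = bclass z S" "\<rho> (pi0 z) = bclass z R"
  shows "onorm (\<lambda>x. (S - R) *v x) \<le> sec_norm B (sec_diff B \<sigma> \<rho>)"
proof -
  have val: "\<exists>w S R. w \<in> P \<and> pi0 w = u \<and> \<sigma> u = bclass w S \<and> \<rho> u = bclass w R" if u: "u \<in> B" for u
  proof -
    obtain w S where w: "w \<in> P" "pi0 w = u" "\<sigma> u = bclass w S"
      using Gamma_c_value[OF assms(1) u] .
    obtain v R where v: "v \<in> P" "pi0 v = u" "\<rho> u = bclass v R"
      using Gamma_c_value[OF assms(2) u] .
    obtain k where "k \<in> unitary_group" "w = conj_tuple k v"
      using same_orbit[OF v(1) w(1)] v(2) w(2) by metis
    then have "\<rho> u = bclass w (conj_mat k R)"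
      unfolding v(3) bclass_eq_iff by blast
    with w show ?thesis by blast
  qed
  obtain M N where M: "\<And>u. u \<in> B \<Longrightarrow> fibre_norm (\<sigma> u) \<le> M"
    and N: "\<And>u. u \<in> B \<Longrightarrow> fibre_norm (\<rho> u) \<le> N"
    using Gamma_c_bounded[OF assms(1)] Gamma_c_bounded[OF assms(2)] by metis
  have "fibre_norm (sec_diff B \<sigma> \<rho> u) \<le> M + N" if u: "u \<in> B" for u
  proof -
    obtain w S R where w: "w \<in> P" "pi0 w = u" "\<sigma> u = bclass w S" "\<rho> u = bclass w R"
      using val[OF u] by blast
    have "fibre_norm (sec_diff B \<sigma> \<rho> u) = onorm (\<lambda>x. (S - R) *v x)"
      using u w(1) by (simp add: sec_diff_def w(3,4) fibre_op_diff_bclass P_Vset fibre_norm_bclass)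
    also have "\<dots> \<le> fibre_norm (\<sigma> u) + fibre_norm (\<rho> u)"
      unfolding w(3,4) fibre_norm_bclass by (rule onorm_matrix_diff_le)
    finally show ?thesis
      using M[OF u] N[OF u] by linarith
  qed
  then have "fibre_norm (sec_diff B \<sigma> \<rho> (pi0 z)) \<le> sec_norm B (sec_diff B \<sigma> \<rho>)"
    unfolding sec_norm_def using z(2) by (intro cSUP_upper) (auto simp: bdd_above_def)
  then show ?thesis
    using z by (simp add: sec_diff_def assms fibre_op_diff_bclass P_Vset fibre_norm_bclass)
qed

lemma S0_unitary_equivariant:
  "\<phi> \<in> S0 \<Longrightarrow> k \<in> unitary_group \<Longrightarrow> \<phi> (conj_tuple k z) = conj_mat k (\<phi> z)"
  by (rule S0_equivariant[OF _ unitary_invertible])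

lemma S0_section_apply:
  "\<phi> \<in> S0 \<Longrightarrow> z \<in> P \<Longrightarrow> pi0 z \<in> B \<Longrightarrow>
     equivariant_section B P \<phi> (pi0 z) = bclass z (\<phi> z)"
  by (rule equivariant_section_apply) (rule S0_unitary_equivariant)

lemma S0_section_Gamma_c: "\<phi> \<in> S0 \<Longrightarrow> equivariant_section B P \<phi> \<in> Gamma_c B P"
  by (rule equivariant_section_Gamma_c)
     (auto intro: S0_unitary_equivariant continuous_on_subset[OF continuous_on_S0])

lemma scalar_unitary_equivariant:
  "k \<in> unitary_group \<Longrightarrow> mat (c (pi0 (conj_tuple k z))) = conj_mat k (mat (c (pi0 z)))"
  by (simp add: pi0_conj conj_mat_scalar unitary_invertible)

lemma scalar_section_apply:
  "z \<in> P \<Longrightarrow> pi0 z \<in> B \<Longrightarrow> scalar_section B P c (pi0 z) = bclass z (mat (c (pi0 z)))"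
  unfolding scalar_section_def
  by (rule equivariant_section_apply) (rule scalar_unitary_equivariant)

lemma section_eqI:
  assumes "\<sigma> \<in> extensional B" "\<rho> \<in> extensional B"
    and "\<And>z. z \<in> P \<Longrightarrow> pi0 z \<in> B \<Longrightarrow> \<sigma> (pi0 z) = \<rho> (pi0 z)"
  shows "\<sigma> = \<rho>"
proof (rule extensionalityI[OF assms(1,2)])
  fix u assume u: "u \<in> B"
  then obtain z where "z \<in> P" "pi0 z = u"
    using pi0_surj B_X by blast
  then show "\<sigma> u = \<rho> u"
    using assms(3) u by blast
qed

lemma scalar_section_extensional: "scalar_section B P c \<in> extensional B"
  by (simp add: scalar_section_def equivariant_section_def)

lemma scalar_section_cong:
  assumes "\<And>u. u \<in> B \<Longrightarrow> c u = c' u"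
  shows "scalar_section B P c = scalar_section B P c'"
  by (rule section_eqI) (simp_all add: scalar_section_extensional scalar_section_apply assms)

lemma tau_scalar_section:
  assumes "u \<in> B"
  shows "tau (scalar_section B P c u) = c u"
proof -
  obtain z where "z \<in> P" "pi0 z = u"
    using pi0_surj assms B_X by blast
  then show ?thesis
    using scalar_section_apply[of z c] assms by (simp add: tau_bclass trace_mat)
qed

lemma scalar_section_tau_scalar_section:
  "scalar_section B P (tau \<circ> scalar_section B P c) = scalar_section B P c"
  by (rule scalar_section_cong) (simp add: tau_scalar_section)

lemma scalar_section_Gamma_c:
  assumes "continuous_map (subtopology Qtop X) euclidean f"
  shows "scalar_section B P f \<in> Gamma_c B P"
  unfolding scalar_section_def
proof (rule equivariant_section_Gamma_c)
  have "continuous_map (top_of_set P) (subtopology Qtop X) pi0"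
    using reduction unfolding is_reduction_def by (blast intro: quotient_imp_continuous_map)
  then have "continuous_map (top_of_set P) euclidean (f \<circ> pi0)"
    using assms by (rule continuous_map_compose)
  then have "continuous_on P (\<lambda>z. f (pi0 z))"
    by (simp add: o_def)
  then have c: "continuous_on {z \<in> P. pi0 z \<in> B} (\<lambda>z. f (pi0 z))"
    by (rule continuous_on_subset) auto
  have "continuous_on {z \<in> P. pi0 z \<in> B} (\<lambda>z. if i = j then f (pi0 z) else 0)" for i j :: 'n
    using c by (cases "i = j") auto
  then show "continuous_on {z \<in> P. pi0 z \<in> B} (\<lambda>z. mat (f (pi0 z)) :: 'n cmat)"
    unfolding mat_def by (intro continuous_on_vec_lambda)
qed (rule scalar_unitary_equivariant)

lemma sec_mult_extensional: "sec_mult B \<sigma> \<rho> \<in> extensional B"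
  by (simp add: sec_mult_def)

lemma sec_mult_apply:
  assumes "z \<in> P" "pi0 z \<in> B" "\<sigma> (pi0 z) = bclass z S" "\<rho> (pi0 z) = bclass z R"
  shows "sec_mult B \<sigma> \<rho> (pi0 z) = bclass z (S ** R)"
  using assms by (simp add: sec_mult_def fibre_op_mult_bclass P_Vset)

lemma Gamma_c_value_at:
  assumes "\<sigma> \<in> Gamma_c B P" "z \<in> P" "pi0 z \<in> B"
  obtains A where "\<sigma> (pi0 z) = bclass z A"
proof -
  obtain w A where w: "w \<in> P" "pi0 w = pi0 z" "\<sigma> (pi0 z) = bclass w A"
    using Gamma_c_value[OF assms(1,3)] .
  obtain k where "k \<in> unitary_group" "z = conj_tuple k w"
    using same_orbit[OF w(1) assms(2) w(2)] .
  then have "bclass w A = bclass z (conj_mat k A)"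
    unfolding bclass_eq_iff by blast
  then show ?thesis
    using that w(3) by metis
qed

lemma scalar_section_central:
  assumes "\<rho> \<in> Gamma_c B P"
  shows "sec_mult B (scalar_section B P c) \<rho> = sec_mult B \<rho> (scalar_section B P c)"
proof (rule section_eqI)
  fix z assume z: "z \<in> P" "pi0 z \<in> B"
  obtain R where R: "\<rho> (pi0 z) = bclass z R"
    using Gamma_c_value_at[OF assms z] .
  show "sec_mult B (scalar_section B P c) \<rho> (pi0 z) = sec_mult B \<rho> (scalar_section B P c) (pi0 z)"
    using sec_mult_apply[of z "scalar_section B P c" _ \<rho> R, OF z scalar_section_apply[OF z] R]
      sec_mult_apply[of z \<rho> R "scalar_section B P c", OF z R scalar_section_apply[OF z]]
    by (simp add: mat_mult_commute)
qed (rule sec_mult_extensional)+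

text \<open>The coordinate sections generate every fibre, so a section that commutes with them is
  fibrewise scalar, and the scalar is its normalized trace.\<close>

lemma commutes_with_coordinates_imp_scalar:
  assumes \<sigma>: "\<sigma> \<in> Gamma_c B P"
    and comm: "\<And>i. sec_mult B \<sigma> (equivariant_section B P (\<lambda>z. z $ i)) =
                   sec_mult B (equivariant_section B P (\<lambda>z. z $ i)) \<sigma>"
  shows "\<sigma> = scalar_section B P (tau \<circ> \<sigma>)"
proof (rule section_eqI)
  show "\<sigma> \<in> extensional B"
    using \<sigma> by (simp add: Gamma_c_def)
  fix z assume z: "z \<in> P" "pi0 z \<in> B"
  obtain A where A: "\<sigma> (pi0 z) = bclass z A"
    using Gamma_c_value_at[OF \<sigma> z] .
  have "A ** z $ i = z $ i ** A" for i
  proof -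
    let ?Z = "equivariant_section B P (\<lambda>z. z $ i)"
    note e = S0_section_apply[OF S0_coord z, of i]
    have "bclass z (A ** z $ i) = bclass z (z $ i ** A)"
      using sec_mult_apply[of z \<sigma> A ?Z, OF z A e] sec_mult_apply[of z ?Z _ \<sigma> A, OF z e A] comm[of i] by simp
    then show ?thesis
      by (simp add: bclass_inject P_Vset z)
  qed
  then have "\<And>M. A ** M = M ** A"
    by (rule Vset_commutant[OF P_Vset[OF z(1)]])
  then obtain c where "A = mat c"
    using commutes_with_all_imp_scalar by blast
  then show "\<sigma> (pi0 z) = scalar_section B P (tau \<circ> \<sigma>) (pi0 z)"
    using z by (simp add: scalar_section_apply A tau_bclass trace_mat)
qed (rule scalar_section_extensional)

end

section \<open>The trace of the tracial function algebra\<close>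

text \<open>The situation in which \<open>B\<close> is a closed boundary for the function algebra \<open>A\<close> on \<open>X\<close>.\<close>

locale boundary_reduction = reduction X P B
  for X :: "('d::finite, 'n::finite) qpoint set" and P :: "('d, 'n) mtuple set" and B +
  fixes A
  defines "A \<equiv> mtopology_of (cfunspace (subtopology Qtop X) euclidean_metric) closure_of restrict_I0 X"
  assumes boundary: "closed_boundary (subtopology Qtop X) A B"
    and B_nonempty: "B \<noteq> {}"
begin

text \<open>The norm closure of the image of the trace algebra in the continuous sections over \<open>B\<close>.\<close>

definition trace_closure :: "('d, 'n) bsection set" where
  "trace_closure = {\<sigma> \<in> Gamma_c B P.
     \<forall>\<epsilon>>0. \<exists>\<phi>\<in>S0. sec_norm B (sec_diff B \<sigma> (equivariant_section B P \<phi>)) < \<epsilon>}"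

lemma trace_closure_Gamma_c: "\<sigma> \<in> trace_closure \<Longrightarrow> \<sigma> \<in> Gamma_c B P"
  by (simp add: trace_closure_def)

lemma sec_norm_diff_le:
  assumes "\<And>z. z \<in> P \<Longrightarrow> pi0 z \<in> B \<Longrightarrow>
    \<exists>S R. \<sigma> (pi0 z) = bclass z S \<and> \<rho> (pi0 z) = bclass z R \<and> onorm (\<lambda>x. (S - R) *v x) \<le> e"
  shows "sec_norm B (sec_diff B \<sigma> \<rho>) \<le> e"
  unfolding sec_norm_def
proof (rule cSUP_least[OF B_nonempty])
  fix u assume u: "u \<in> B"
  then obtain z where z: "z \<in> P" "pi0 z = u"
    using pi0_surj B_X by blast
  then obtain S R where "\<sigma> u = bclass z S" "\<rho> u = bclass z R" "onorm (\<lambda>x. (S - R) *v x) \<le> e"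
    using assms[of z] u by blast
  then show "fibre_norm (sec_diff B \<sigma> \<rho> u) \<le> e"
    using u z(1) by (simp add: sec_diff_def fibre_op_diff_bclass P_Vset fibre_norm_bclass)
qed

lemma S0_section_trace_closure:
  assumes "\<phi> \<in> S0"
  shows "equivariant_section B P \<phi> \<in> trace_closure"
proof -
  have "sec_norm B (sec_diff B (equivariant_section B P \<phi>) (equivariant_section B P \<phi>)) \<le> 0"
  proof (rule sec_norm_diff_le)
    fix z assume "z \<in> P" "pi0 z \<in> B"
    then have "equivariant_section B P \<phi> (pi0 z) = bclass z (\<phi> z)"
      by (rule S0_section_apply[OF assms])
    moreover have "onorm (\<lambda>x. (\<phi> z - \<phi> z) *v x) \<le> 0"
      by (simp add: onorm_zero)
    ultimately show "\<exists>S R. equivariant_section B P \<phi> (pi0 z) = bclass z S \<and>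
        equivariant_section B P \<phi> (pi0 z) = bclass z R \<and> onorm (\<lambda>x. (S - R) *v x) \<le> 0"
      by blast
  qed
  then show ?thesis
    unfolding trace_closure_def using S0_section_Gamma_c[OF assms] assms
    by (auto intro: order_le_less_trans)
qed

lemma scalar_section_trace_closure:
  assumes f: "f \<in> A"
  shows "scalar_section B P f \<in> trace_closure"
  unfolding trace_closure_def
proof (intro CollectI conjI allI impI)
  have f': "continuous_map (subtopology Qtop X) euclidean f"
    "\<forall>e>0. \<exists>p\<in>I0. \<forall>u\<in>X. cmod (f u - u p) \<le> e"
    using f unfolding A_def mem_closure_restrict_I0[OF X] by blast+
  show "scalar_section B P f \<in> Gamma_c B P"
    by (rule scalar_section_Gamma_c[OF f'(1)])
  fix e :: real assume "e > 0"
  then have "\<exists>p\<in>I0. \<forall>u\<in>X. cmod (f u - u p) \<le> e / 2"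
    using f'(2) half_gt_zero by blast
  then obtain p where p: "p \<in> I0" "\<And>u. u \<in> X \<Longrightarrow> cmod (f u - u p) \<le> e / 2"
    by blast
  have pS: "(\<lambda>z. mat (p z)) \<in> S0"
    by (rule S0_scalar[OF p(1)])
  have "sec_norm B (sec_diff B (scalar_section B P f) (equivariant_section B P (\<lambda>z. mat (p z)))) \<le> e / 2"
  proof (rule sec_norm_diff_le)
    fix z assume z: "z \<in> P" "pi0 z \<in> B"
    have "onorm (\<lambda>x. (mat (f (pi0 z)) - mat (p z) :: 'n cmat) *v x) \<le> cmod (f (pi0 z) - p z)"
      using onorm_mat_le[of "f (pi0 z) - p z"] by (simp add: mat_diff)
    also have "\<dots> \<le> e / 2"
      using p(2)[of "pi0 z"] z(2) B_X p(1) by (auto simp: pi0_apply)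
    finally show "\<exists>S R. scalar_section B P f (pi0 z) = bclass z S \<and>
        equivariant_section B P (\<lambda>z. mat (p z)) (pi0 z) = bclass z R \<and> onorm (\<lambda>x. (S - R) *v x) \<le> e / 2"
      using scalar_section_apply[OF z] S0_section_apply[OF pS z] by blast
  qed
  also have "\<dots> < e"
    using \<open>e > 0\<close> by simp
  finally have lt: "sec_norm B (sec_diff B (scalar_section B P f)
      (equivariant_section B P (\<lambda>z. mat (p z)))) < e" .
  show "\<exists>\<phi>\<in>S0. sec_norm B (sec_diff B (scalar_section B P f) (equivariant_section B P \<phi>)) < e"
    by (rule bexI[where x = "\<lambda>z. mat (p z)"]) (rule lt, rule pS)
qed

lemma tau_trace_closure:
  assumes \<sigma>: "\<sigma> \<in> trace_closure"
  obtains f where "f \<in> A" "\<And>u. u \<in> B \<Longrightarrow> f u = tau (\<sigma> u)"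
proof -
  have "\<exists>p\<in>I0. \<forall>u\<in>B. cmod (tau (\<sigma> u) - u p) \<le> e" if "e > 0" for e
  proof -
    obtain \<phi> where \<phi>: "\<phi> \<in> S0" "sec_norm B (sec_diff B \<sigma> (equivariant_section B P \<phi>)) < e"
      using \<sigma> \<open>e > 0\<close> unfolding trace_closure_def by blast
    let ?p = "\<lambda>z. trace (\<phi> z) / of_nat CARD('n)"
    note p = normalized_trace_S0[OF \<phi>(1)]
    show ?thesis
    proof (intro bexI[OF _ p] ballI)
      fix u assume u: "u \<in> B"
      obtain z S where z: "z \<in> P" "pi0 z = u" "\<sigma> u = bclass z S"
        using Gamma_c_value[OF trace_closure_Gamma_c[OF \<sigma>] u] .
      have zB: "pi0 z \<in> B" using u z(2) by simp
      have "onorm (\<lambda>x. (S - \<phi> z) *v x) < e"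
        using fibre_norm_le_sec_norm_diff[OF trace_closure_Gamma_c[OF \<sigma>] S0_section_Gamma_c[OF \<phi>(1)]
            z(1) zB _ S0_section_apply[OF \<phi>(1) z(1) zB], of S] z \<phi>(2) by simp
      moreover have "tau (\<sigma> u) - u ?p = trace (S - \<phi> z) / of_nat CARD('n)"
        using pi0_apply[OF p, of z]
        by (simp add: z tau_bclass trace_def sum_subtractf diff_divide_distrib)
      moreover have "cmod (trace (S - \<phi> z) / of_nat CARD('n)) \<le> onorm (\<lambda>x. (S - \<phi> z) *v x)"
        using cmod_trace_le_onorm[of "S - \<phi> z"] by (simp add: norm_divide field_simps)
      ultimately show "cmod (tau (\<sigma> u) - u ?p) \<le> e"
        by simp
    qed
  qed
  then show thesis
    using extend_uniform_limit_from_boundary[OF X boundary[unfolded A_def], of "\<lambda>u. tau (\<sigma> u)"] that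
    unfolding A_def by blast
qed

lemma expectation_image:
  "(\<lambda>\<sigma>. scalar_section B P (tau \<circ> \<sigma>)) ` trace_closure = scalar_section B P ` A"
proof (intro subset_antisym image_subsetI)
  fix \<sigma> assume "\<sigma> \<in> trace_closure"
  then obtain f where "f \<in> A" and f: "\<And>u. u \<in> B \<Longrightarrow> f u = tau (\<sigma> u)"
    using tau_trace_closure by blast
  have "scalar_section B P (tau \<circ> \<sigma>) = scalar_section B P f"
    by (rule scalar_section_cong) (simp add: f)
  then show "scalar_section B P (tau \<circ> \<sigma>) \<in> scalar_section B P ` A"
    using \<open>f \<in> A\<close> by (rule image_eqI)
next
  fix f assume "f \<in> A"
  then show "scalar_section B P f \<in> (\<lambda>\<sigma>. scalar_section B P (tau \<circ> \<sigma>)) ` trace_closure"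
    by (intro image_eqI[where x = "scalar_section B P f"] scalar_section_trace_closure)
       (simp add: scalar_section_tau_scalar_section)
qed

lemma center_trace_closure: "sec_center B trace_closure = scalar_section B P ` A"
proof (intro subset_antisym image_subsetI subsetI)
  fix \<sigma> assume "\<sigma> \<in> sec_center B trace_closure"
  then have \<sigma>: "\<sigma> \<in> trace_closure" "\<And>\<rho>. \<rho> \<in> trace_closure \<Longrightarrow> sec_mult B \<sigma> \<rho> = sec_mult B \<rho> \<sigma>"
    by (auto simp: sec_center_def)
  have "\<sigma> = scalar_section B P (tau \<circ> \<sigma>)"
    by (rule commutes_with_coordinates_imp_scalar[OF trace_closure_Gamma_c[OF \<sigma>(1)]])
       (rule \<sigma>(2)[OF S0_section_trace_closure[OF S0_coord]])
  then show "\<sigma> \<in> scalar_section B P ` A"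
    using expectation_image \<sigma>(1) by blast
next
  fix f assume "f \<in> A"
  then show "scalar_section B P f \<in> sec_center B trace_closure"
    unfolding sec_center_def
    using scalar_section_trace_closure scalar_section_central trace_closure_Gamma_c by blast
qed

end

theorem theorem3p1:
  fixes D :: "('d::finite, 'n::finite) qpoint set"
    and P :: "('d, 'n) mtuple set"
  assumes "CARD('d) \<ge> 2"
    and "CARD('n) \<ge> 2"
    and "domain_in_Q0 D"
    and "compactin Qtop (Qtop closure_of D)"
    and "Qtop closure_of D \<subseteq> Q0"
    and "is_reduction (Qtop closure_of D) P"
  shows "expectation_T D P ` tracial_algebra_S D P = embedded_I D P \<and>
         sec_center (bdry D) (tracial_algebra_S D P) = embedded_I D P"
proof -
  define X where "X = Qtop closure_of D"
  have A: "function_algebra_I D =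
      mtopology_of (cfunspace (subtopology Qtop X) euclidean_metric) closure_of restrict_I0 X"
    by (simp add: function_algebra_I_def X_def Let_def)
  have "D \<subseteq> topspace Qtop"
    using assms(3) connectedin_subset_topspace unfolding domain_in_Q0_def by blast
  then have "X \<noteq> {}"
    using assms(3) closure_of_subset unfolding X_def domain_in_Q0_def by blast
  interpret F: function_alg "subtopology Qtop X" "function_algebra_I D"
    unfolding A using assms(4) \<open>X \<noteq> {}\<close> unfolding X_def by (rule function_alg_closure_restrict_I0)
  have B: "closed_boundary (subtopology Qtop X) (function_algebra_I D) (bdry D)"
    unfolding bdry_def X_def[symmetric] by (rule F.shilov_boundary_closed_boundary)
  interpret boundary_reduction X P "bdry D" "function_algebra_I D"
  proof unfold_locales
    show "is_reduction X P" "compactin Qtop X"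
      using assms unfolding X_def by blast+
    show "closedin (subtopology Qtop X) (bdry D)"
      using B by (simp add: closed_boundary_def)
    show "bdry D \<noteq> {}"
      using B F.const[of 0] unfolding closed_boundary_def by blast
  qed (use A B in auto)
  have S: "tracial_algebra_S D P = trace_closure"
    by (simp add: tracial_algebra_S_def trace_closure_def Psi_def)
  have T: "expectation_T D P = (\<lambda>\<sigma>. scalar_section (bdry D) P (tau \<circ> \<sigma>))"
    by (simp add: fun_eq_iff expectation_T_def)
  have "scalar_section (bdry D) P (restrict f (bdry D)) = scalar_section (bdry D) P f" for f
    by (rule scalar_section_cong) simp
  then have I: "embedded_I D P = scalar_section (bdry D) P ` function_algebra_I D"
    by (simp add: embedded_I_def)
  show ?thesis
    unfolding S T I using expectation_image center_trace_closure by blast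
qed

end
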